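(* Let $n\in\mathbb{N}$. Then $$t(1,1,4,4;n)=2\big(\sigma(4n+5)+(-1)^n S_4(4n+5)\big).$$
   Context: $\mathbb{N}$ denotes the set of positive integers. For $a,b,c,d\in\mathbb{N}$ and an integer $m\ge0$, $t(a,b,c,d;m)$ is the number of $(x,y,z,w)\in\mathbb{Z}^4$ with $m = a\frac{x(x-1)}{2}+b\frac{y(y-1)}{2}+c\frac{z(z-1)}{2}+d\frac{w(w-1)}{2}$. $\sigma(m)$ is the sum of the positive divisors of $m$. For $m,k\in\mathbb{N}$ with $m$ even and $k$ odd, $S_m(k)=\sum r$, the sum over all $(r,s)\in\mathbb{Z}\times\mathbb{Z}$ with $k=r^2+ms^2$ and $r\equiv1\pmod 4$. *)

theory Defs
  imports Main "HOL-Number_Theory.Cong"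
begin

text \<open>Here \<open>div 2\<close> is exact, because \<open>x * (x - 1)\<close> is even. For positive \<open>a\<close>, \<open>b\<close>, \<open>c\<close>, \<open>d\<close>
  the set of representations is finite, so \<open>card\<close> is the number of its elements.\<close>

definition tri_reps :: "nat \<Rightarrow> nat \<Rightarrow> nat \<Rightarrow> nat \<Rightarrow> nat \<Rightarrow> nat" where
  "tri_reps a b c d m = card {(x :: int, y :: int, z :: int, w :: int).
     int m = int a * (x * (x - 1) div 2) + int b * (y * (y - 1) div 2)
           + int c * (z * (z - 1) div 2) + int d * (w * (w - 1) div 2)}"

text \<open>Intended for positive arguments.\<close>

definition sigma :: "nat \<Rightarrow> nat" where
  "sigma m = (\<Sum>d | d dvd m. d)"

text \<open>Intended for positive even \<open>m\<close> and odd \<open>k\<close>. For positive \<open>m\<close> the sum is over a finite set.\<close>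

definition S_sum :: "nat \<Rightarrow> nat \<Rightarrow> int" where
  "S_sum m k = (\<Sum>(r, s) \<in> {(r :: int, s :: int). int k = r\<^sup>2 + int m * s\<^sup>2 \<and> [r = 1] (mod 4)}. r)"

lemma abs_le_square_int: "\<bar>x\<bar> \<le> x\<^sup>2" for x :: int
  using self_le_power[of "\<bar>x\<bar>" 2] by (cases "x = 0") auto

lemma finite_S_sum_index:
  assumes "m > 0"
  shows "finite {(r :: int, s :: int). int k = r\<^sup>2 + int m * s\<^sup>2 \<and> [r = 1] (mod 4)}"
proof (rule finite_subset)
  show "finite ({- int k..int k} \<times> {- int k..int k})" by simp
  have "\<bar>r\<bar> \<le> int k \<and> \<bar>s\<bar> \<le> int k" if "int k = r\<^sup>2 + int m * s\<^sup>2" for r s :: int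
  proof -
    have "s\<^sup>2 \<le> int m * s\<^sup>2" using assms mult_right_mono[of 1 "int m" "s\<^sup>2"] by simp
    then show ?thesis
      using that abs_le_square_int[of r] abs_le_square_int[of s]
        zero_le_power2[of r] zero_le_power2[of s] by linarith
  qed
  then show "{(r :: int, s :: int). int k = r\<^sup>2 + int m * s\<^sup>2 \<and> [r = 1] (mod 4)}
      \<subseteq> {- int k..int k} \<times> {- int k..int k}"
    unfolding abs_le_iff by fastforce
qed

lemma triangular_bound:
  fixes x :: int
  shows "\<bar>x\<bar> \<le> x * (x - 1) div 2 + 1" and "0 \<le> x * (x - 1) div 2"
proof -
  have nonneg: "0 \<le> y * (y - 1)" for y :: int
    by (cases "y \<ge> 1") (simp_all add: mult_nonpos_nonpos)
  have "2 * x \<le> x * (x - 1) + 2" "- 2 * x \<le> x * (x - 1) + 2"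
    using nonneg[of "x - 1"] nonneg[of "x + 1"] by (simp_all add: algebra_simps)
  then show "\<bar>x\<bar> \<le> x * (x - 1) div 2 + 1" by linarith
  show "0 \<le> x * (x - 1) div 2" using nonneg[of x] by simp
qed

lemma finite_tri_reps_index:
  assumes "a > 0" "b > 0" "c > 0" "d > 0"
  shows "finite {(x :: int, y :: int, z :: int, w :: int).
     int m = int a * (x * (x - 1) div 2) + int b * (y * (y - 1) div 2)
           + int c * (z * (z - 1) div 2) + int d * (w * (w - 1) div 2)}"
proof (rule finite_subset)
  let ?I = "{- int m - 1..int m + 1}"
  show "finite (?I \<times> ?I \<times> ?I \<times> ?I)" by simp
  define T :: "int \<Rightarrow> int" where "T u = u * (u - 1) div 2" for u
  have T: "\<bar>u\<bar> \<le> T u + 1" "0 \<le> T u" for u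
    unfolding T_def by (rule triangular_bound)+
  have T_le: "T u \<le> int e * T u" if "e > 0" for e u
    using mult_right_mono[of 1 "int e" "T u"] that T(2)[of u] by simp
  have bound: "u \<in> ?I" if "T u \<le> int m" for u
    using that T(1)[of u] by auto
  have "x \<in> ?I \<and> y \<in> ?I \<and> z \<in> ?I \<and> w \<in> ?I"
    if "int m = int a * T x + int b * T y + int c * T z + int d * T w" for x y z w
  proof -
    have "T x \<le> int m" "T y \<le> int m" "T z \<le> int m" "T w \<le> int m"
      using that T_le[OF assms(1), of x] T_le[OF assms(2), of y] T_le[OF assms(3), of z]
        T_le[OF assms(4), of w] T(2)[of x] T(2)[of y] T(2)[of z] T(2)[of w] by linarith+
    then show ?thesis using bound by blast
  qed
  then show "{(x :: int, y :: int, z :: int, w :: int).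
     int m = int a * (x * (x - 1) div 2) + int b * (y * (y - 1) div 2)
           + int c * (z * (z - 1) div 2) + int d * (w * (w - 1) div 2)} \<subseteq> ?I \<times> ?I \<times> ?I \<times> ?I"
    unfolding T_def by fast
qed

end

theory Submission
  imports Defs
begin

text \<open>
  Put \<open>k = 4 * n + 5\<close>. Passing to sums and differences of coordinates turns \<open>t(1,1,4,4;n)\<close> into twice
  the number of solutions of \<open>u\<^sup>2 + 4 * a\<^sup>2 + 4 * b\<^sup>2 + 4 * c\<^sup>2 = k\<close> with \<open>u\<close> odd in which \<open>a\<close> and \<open>n\<close>
  have the same parity. Hence it suffices that there are \<open>2 * \<sigma>(k)\<close> solutions altogether, which is
  Jacobi's four-square theorem, and that the sum of \<open>(-1)\<^sup>a\<close> over them is \<open>2 * S\<^sub>4(k)\<close>. For fixed \<open>c\<close>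
  the latter is an arithmetic version of Jacobi's identity for the cube of the eta function, and it
  follows from the two-square theorem and an alternating sum over \<open>u\<^sup>2 + 4 * d * e = N\<close>.

  The theorems on sums of squares come from a recursion. If \<open>R(m)\<close> is the number of representations
  of \<open>4 * m\<close> by four odd squares, then the sum of \<open>(m - u\<^sup>2) * R(m)\<close> over \<open>u\<^sup>2 + 4 * m = N\<close> vanishes
  by symmetry of the five squares, and this determines \<open>R\<close>. That the divisor sum satisfies the same
  recursion is an identity for sums over \<open>u\<^sup>2 + 4 * d * e = N\<close>, proved by sign-reversing involutions
  that resemble Zagier's for primes of the form \<open>x\<^sup>2 + y\<^sup>2\<close>.
\<close>

section \<open>Signs, index sets and a recursion\<close>

text \<open>The nontrivial Dirichlet character modulo 4, extended to negative integers.\<close>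

definition chi :: "int \<Rightarrow> int" where
  "chi d = (if even d then 0 else if d mod 4 = 1 then 1 else - 1)"

definition alt :: "int \<Rightarrow> int" where
  "alt a = (if even a then 1 else - 1)"

lemma odd_square_mod_8: "odd u \<Longrightarrow> u\<^sup>2 mod 8 = 1" for u :: int
proof -
  assume "odd u"
  then obtain k where k: "u = 2 * k + 1" by (auto elim: oddE)
  have "even (k * (k + 1))" by simp
  then obtain j where "k * (k + 1) = 2 * j" by (rule evenE)
  then have "u\<^sup>2 = 8 * j + 1" unfolding k by (simp add: power2_eq_square algebra_simps)
  then show ?thesis by simp
qed

lemma sum_involution_eq_0:
  fixes g :: "'a \<Rightarrow> int"
  assumes "\<And>x. x \<in> S \<Longrightarrow> f x \<in> S" "\<And>x. x \<in> S \<Longrightarrow> f (f x) = x"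
    and "\<And>x. x \<in> S \<Longrightarrow> g (f x) = - g x"
  shows "sum g S = 0"
proof -
  have "sum g S = (\<Sum>x\<in>S. - g x)"
    by (rule sum.reindex_bij_witness[where i = f and j = f]) (use assms in auto)
  then show ?thesis by (simp add: sum_negf)
qed

text \<open>A triple in \<open>quad_div 4 N\<close> is an indefinite binary form
  \<open>d x^2 + u x y - e y^2\<close> of discriminant \<open>N\<close>; one in
  \<open>quad_div 2 N\<close> is read as \<open>d x^2 + 2 u x y - 2 e y^2\<close>, of discriminant
  \<open>4 * N\<close>. The signs of the outer coefficients place the form on its river and leave
  only finitely many triples, while \<open>u\<close> may have either sign.\<close>

definition quad_div :: "int \<Rightarrow> int \<Rightarrow> (int \<times> int \<times> int) set" where
  "quad_div c N = {(u, d, e). u\<^sup>2 + c * (d * e) = N \<and> d > 0 \<and> e > 0}"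

definition quad_lin :: "int \<Rightarrow> int \<Rightarrow> (int \<times> int) set" where
  "quad_lin c N = {(u, m). u\<^sup>2 + c * m = N \<and> m > 0}"

lemma quad_lin_bounds:
  assumes "c > 0" "(u, m) \<in> quad_lin c N"
  shows "\<bar>u\<bar> \<le> N" "0 < m" "m \<le> N"
proof -
  have m: "m > 0" and eq: "u\<^sup>2 + c * m = N" using assms(2) by (auto simp: quad_lin_def)
  have "m \<le> c * m" using m assms(1) by simp
  then show "\<bar>u\<bar> \<le> N" "0 < m" "m \<le> N"
    using m eq abs_le_square_int[of u] zero_le_power2[of u] by linarith+
qed

lemma finite_quad_lin:
  assumes "c > 0"
  shows "finite (quad_lin c N)"
proof (rule finite_subset)
  show "quad_lin c N \<subseteq> {-N..N} \<times> {0..N}"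
    using quad_lin_bounds[OF assms] by (fastforce simp: abs_le_iff)
qed simp

lemma finite_quad_div:
  assumes "c > 0"
  shows "finite (quad_div c N)"
proof (rule finite_subset)
  show "quad_div c N \<subseteq> {-N..N} \<times> {0..N} \<times> {0..N}"
  proof
    fix p assume p_in: "p \<in> quad_div c N"
    obtain u d e where p: "p = (u, d, e)" by (cases p)
    have h: "(u, d, e) \<in> quad_div c N" using p_in p by simp
    then have "(u, d * e) \<in> quad_lin c N" by (simp add: quad_div_def quad_lin_def)
    moreover have "d > 0" "e > 0" using h by (auto simp: quad_div_def)
    moreover have "d \<le> d * e" "e \<le> d * e" using \<open>d > 0\<close> \<open>e > 0\<close> by simp_all
    ultimately have "\<bar>u\<bar> \<le> N" "d \<le> N" "e \<le> N"
      using quad_lin_bounds[OF assms, of u "d * e" N] by linarith+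
    then show "p \<in> {-N..N} \<times> {0..N} \<times> {0..N}"
      unfolding p using \<open>d > 0\<close> \<open>e > 0\<close> by (auto simp: abs_le_iff)
  qed
qed simp

text \<open>A divisor \<open>d\<close> of \<open>m\<close> amounts to a factorization
  \<open>m = d * e\<close>. This puts the recursion for a divisor sum into the shape to which the
  involutions on forms apply.\<close>

lemma sum_quad_div:
  fixes f :: "int \<Rightarrow> int"
  assumes "c > 0"
  shows "(\<Sum>(u, m) \<in> quad_lin c N. g u m * (\<Sum>d | d > 0 \<and> d dvd m. f d))
    = (\<Sum>(u, d, e) \<in> quad_div c N. g u (d * e) * f d)"
proof -
  have "(\<Sum>(u, m) \<in> quad_lin c N. g u m * (\<Sum>d | d > 0 \<and> d dvd m. f d))
     = (\<Sum>p \<in> quad_lin c N. \<Sum>d | d > 0 \<and> d dvd snd p. g (fst p) (snd p) * f d)"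
    by (simp add: sum_distrib_left case_prod_beta)
  also have "\<dots> = (\<Sum>q \<in> Sigma (quad_lin c N) (\<lambda>p. {d. d > 0 \<and> d dvd snd p}).
      g (fst (fst q)) (snd (fst q)) * f (snd q))"
  proof (subst sum.Sigma)
    have "finite {d. d > 0 \<and> d dvd m}" if "m > 0" for m :: int
      by (rule finite_subset[of _ "{0..m}"]) (use that in \<open>auto dest: zdvd_imp_le\<close>)
    then show "\<forall>p \<in> quad_lin c N. finite {d. d > 0 \<and> d dvd snd p}"
      by (auto simp: quad_lin_def)
  qed (auto simp: finite_quad_lin[OF assms] case_prod_beta)
  also have "\<dots> = (\<Sum>(u, d, e) \<in> quad_div c N. g u (d * e) * f d)"
    by (rule sum.reindex_bij_witness[where
          i = "\<lambda>(u, d, e). ((u, d * e), d)" and j = "\<lambda>((u, m), d). (u, d, m div d)"])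
      (auto simp: quad_lin_def quad_div_def pos_imp_zdiv_pos_iff zdvd_imp_le)
  finally show ?thesis .
qed

text \<open>
  The terms \<open>u = 1\<close> and \<open>u = -1\<close> contribute \<open>2 * (m - 1) * A m\<close>; all others involve smaller arguments.
\<close>

lemma quad_lin_recursion_unique:
  fixes A :: "int \<Rightarrow> int"
  assumes c: "c > 0" "even c"
    and rec: "\<And>m. P m \<Longrightarrow> m > 0 \<Longrightarrow> (\<Sum>(u, k) \<in> quad_lin c (c * m + 1). (k - u\<^sup>2) * A k) = 0"
    and base: "A 1 = 0"
    and closed: "\<And>m u k. P m \<Longrightarrow> (u, k) \<in> quad_lin c (c * m + 1) \<Longrightarrow> P k"
    and "P m" "m > 0"
  shows "A m = 0"
  using \<open>P m\<close> \<open>m > 0\<close>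
proof (induction "nat m" arbitrary: m rule: less_induct)
  case (less m)
  let ?I = "quad_lin c (c * m + 1)"
  have small: "k < m" if "(u, k) \<in> ?I" "(u, k) \<noteq> (1, m)" "(u, k) \<noteq> (-1, m)" for u k
  proof -
    have eq: "u\<^sup>2 + c * k = c * m + 1" using that(1) by (simp add: quad_lin_def)
    have "odd (u\<^sup>2 + c * k)" unfolding eq using c(2) by simp
    then have "u \<noteq> 0" using c(2) by auto
    have "\<bar>u\<bar> \<noteq> 1"
    proof
      assume "\<bar>u\<bar> = 1"
      then have "u\<^sup>2 = 1" by (simp add: power2_eq_1_iff abs_if split: if_splits)
      then have "k = m" using eq c(1) by simp
      then show False using \<open>\<bar>u\<bar> = 1\<close> that(2,3) by (auto simp: abs_if split: if_splits)
    qed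
    then have "\<bar>u\<bar> > 1" using \<open>u \<noteq> 0\<close> by linarith
    then have "u\<^sup>2 > 1" using abs_le_square_int[of u] by linarith
    then have "c * k < c * m" using eq by linarith
    then show ?thesis using c(1) by simp
  qed
  have "0 = (\<Sum>(u, k) \<in> ?I. (k - u\<^sup>2) * A k)" using rec less.prems by simp
  also have "\<dots> = (\<Sum>(u, k) \<in> {(1, m), (-1, m)}. (k - u\<^sup>2) * A k)"
  proof (rule sum.mono_neutral_right)
    show "\<forall>p \<in> ?I - {(1, m), (-1, m)}. (case p of (u, k) \<Rightarrow> (k - u\<^sup>2) * A k) = 0"
    proof
      fix p assume h: "p \<in> ?I - {(1, m), (-1, m)}"
      obtain u k where p: "p = (u, k)" by (cases p)
      have "k < m" "k > 0" using h small unfolding p by (auto simp: quad_lin_def)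
      moreover have "P k" using closed h less.prems unfolding p by blast
      ultimately have "A k = 0" using less.hyps[of k] by simp
      then show "(case p of (u, k) \<Rightarrow> (k - u\<^sup>2) * A k) = 0" by (simp add: p)
    qed
  next
    show "finite ?I" using c by (rule_tac finite_quad_lin)
    show "{(1, m), (-1, m)} \<subseteq> ?I" using less.prems by (simp add: quad_lin_def)
  qed
  also have "\<dots> = 2 * ((m - 1) * A m)" by simp
  \<comment> \<open>At \<open>m = 1\<close> the coefficient \<open>m - 1\<close> vanishes and the
    recursion says nothing, so the value there has to come from \<open>base\<close>.\<close>
  finally have "m = 1 \<or> A m = 0" by simp
  then show ?case using base by auto
qed

section \<open>Alternating and weighted sums over indefinite binary forms\<close>

text \<open>
  Writing \<open>v = e - u - d\<close>, the summand \<open>?G\<close> equals \<open>(d + e) * (e - v) * (d + v)\<close>, which is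
  antisymmetric under the exchange of \<open>e\<close> and \<open>v\<close>. This exchange is a step along the river of
  Conway's topograph of the form \<open>d x\<^sup>2 + u x y - e y\<^sup>2\<close>; the correction \<open>u * (d\<^sup>2 - e\<^sup>2)\<close> is odd
  in \<open>u\<close> and does not contribute to the sum.
\<close>

lemma sum_quad_div_4:
  assumes nonsq: "\<And>r. r\<^sup>2 \<noteq> N"
  shows "(\<Sum>(u, d, e) \<in> quad_div 4 N. (d * e - u\<^sup>2) * d) = 0"
proof -
  let ?S = "quad_div 4 N"
  let ?G = "\<lambda>(u, d, e). (d + e) * (d * e - u\<^sup>2) - u * (d\<^sup>2 - e\<^sup>2)"
  let ?S1 = "{(u, d, e) \<in> ?S. e > u + d}" and ?S2 = "{(u, d, e) \<in> ?S. e < u + d}"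
  \<comment> \<open>The form takes the value \<open>d + u - e\<close> at (1, 1). If this is zero,
    the discriminant is the square of \<open>u + 2 * d\<close>; hence for nonsquare \<open>N\<close>
    the two regions cover all triples.\<close>
  have "e \<noteq> u + d" if "(u, d, e) \<in> ?S" for u d e
  proof
    assume "e = u + d"
    then have "(u + 2 * d)\<^sup>2 = N"
      using that by (simp add: quad_div_def power2_eq_square algebra_simps)
    then show False using nonsq by blast
  qed
  then have split: "?S = ?S1 \<union> ?S2" by force
  have G1: "sum ?G ?S1 = 0"
    by (rule sum_involution_eq_0[where f = "\<lambda>(u, d, e). (- u - 2 * d, d, e - u - d)"])
      (auto simp: quad_div_def power2_eq_square algebra_simps)
  \<comment> \<open>Passing from \<open>(u, d, e)\<close> to \<open>(- u, e, d)\<close> preserves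
    \<open>?G\<close> and exchanges the two regions.\<close>
  have "sum ?G ?S2 = sum ?G ?S1"
    by (rule sum.reindex_bij_witness[where i = "\<lambda>(u, d, e). (- u, e, d)"
          and j = "\<lambda>(u, d, e). (- u, e, d)"])
      (auto simp: quad_div_def power2_eq_square algebra_simps)
  then have "sum ?G ?S = 0"
    using G1 by (subst split, subst sum.union_disjoint)
      (auto intro: finite_subset[OF _ finite_quad_div[of 4 N]])
  moreover have "(\<Sum>(u, d, e) \<in> ?S. u * (d\<^sup>2 - e\<^sup>2)) = 0"
    by (rule sum_involution_eq_0[where f = "\<lambda>(u, d, e). (- u, d, e)"])
      (auto simp: quad_div_def)
  \<comment> \<open>By this symmetry the weight \<open>d + e\<close> in \<open>?G\<close> counts the
    wanted sum twice.\<close>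
  moreover have "(\<Sum>(u, d, e) \<in> ?S. (d * e - u\<^sup>2) * e) = (\<Sum>(u, d, e) \<in> ?S. (d * e - u\<^sup>2) * d)"
    by (rule sum.reindex_bij_witness[where i = "\<lambda>(u, d, e). (u, e, d)"
          and j = "\<lambda>(u, d, e). (u, e, d)"])
      (auto simp: quad_div_def algebra_simps)
  moreover have "sum ?G ?S = (\<Sum>(u, d, e) \<in> ?S. (d * e - u\<^sup>2) * d)
      + (\<Sum>(u, d, e) \<in> ?S. (d * e - u\<^sup>2) * e) - (\<Sum>(u, d, e) \<in> ?S. u * (d\<^sup>2 - e\<^sup>2))"
    unfolding sum.distrib[symmetric] sum_subtractf[symmetric]
    by (rule sum.cong) (auto simp: algebra_simps)
  ultimately show ?thesis by linarith
qed

text \<open>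
  Here \<open>?G\<close> is the summand plus \<open>u * (e - d) * chi d\<close>, and the three involutions are the steps
  along the river of \<open>d x\<^sup>2 + 2 u x y - 2 e y\<^sup>2\<close> between neighbouring pairs of one odd and one
  even value.
\<close>

lemma sum_quad_div_2:
  assumes N: "N mod 8 = 3"
  shows "(\<Sum>(u, d, e) \<in> quad_div 2 N. (d * e - u\<^sup>2) * chi d) = 0"
proof -
  let ?S = "quad_div 2 N"
  let ?G = "\<lambda>(u, d, e). (u + d) * (e - u) * chi d"
  \<comment> \<open>The regions record signs of the form: negative at (2, 1) in \<open>?S1\<close>,
    positive at (1, 1) in \<open>?S2\<close>, and positive at (2, 1) but negative at (1, 1) in
    \<open>?S3\<close>.\<close>
  let ?S1 = "{(u, d, e) \<in> ?S. e > 2 * u + 2 * d}"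
  let ?S2 = "{(u, d, e) \<in> ?S. d > 2 * e - 2 * u}"
  let ?S3 = "{(u, d, e) \<in> ?S. e < 2 * u + 2 * d \<and> d < 2 * e - 2 * u}"
  have odds: "odd u" "odd d" "odd e" if "(u, d, e) \<in> ?S" for u d e
  proof -
    have eq: "u\<^sup>2 + 2 * (d * e) = N" using that by (simp add: quad_div_def)
    have "odd N" using N by presburger
    then show "odd u" unfolding eq[symmetric] by simp
    then have "(1 + 2 * (d * e)) mod 8 = 3"
      using N odd_square_mod_8[of u] unfolding eq[symmetric] by (metis mod_add_left_eq)
    moreover have "odd x" if "(1 + 2 * x) mod 8 = 3" for x :: int using that by presburger
    ultimately have "odd (d * e)" by blast
    then show "odd d" "odd e" by auto
  qed
  \<comment> \<open>An odd number is compared with an even one, so parity rules out the boundary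
    cases and no terms are left over.\<close>
  have "e \<noteq> 2 * u + 2 * d" "d \<noteq> 2 * e - 2 * u" if "(u, d, e) \<in> ?S" for u d e
    using odds[OF that] by auto
  then have split: "?S = ?S1 \<union> ?S2 \<union> ?S3" by force
  have G1: "sum ?G ?S1 = 0"
    by (rule sum_involution_eq_0[where f = "\<lambda>(u, d, e). (- u - 2 * d, d, e - 2 * u - 2 * d)"])
      (auto simp: quad_div_def power2_eq_square algebra_simps)
  \<comment> \<open>The involutions on \<open>?S1\<close> and \<open>?S2\<close> reverse the sign of
    \<open>(u + d) * (e - u)\<close> and keep \<open>chi d\<close>; the one on \<open>?S3\<close>
    keeps the product and reverses \<open>chi d\<close>.\<close>
  have chi2: "chi (d + 2 * u - 2 * e) = chi d" if "odd u" "odd e" for d u e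
    using that unfolding chi_def by presburger
  have chi3: "chi (2 * e - 2 * u - d) = - chi d" if "odd u" "odd e" for d u e
    using that unfolding chi_def by presburger
  have G2: "sum ?G ?S2 = 0"
  proof (rule sum_involution_eq_0[where f = "\<lambda>(u, d, e). (2 * e - u, d + 2 * u - 2 * e, e)"],
      goal_cases)
    case (3 x)
    then show ?case using odds chi2 by (auto simp: algebra_simps)
  qed (auto simp: quad_div_def power2_eq_square algebra_simps)
  have G3: "sum ?G ?S3 = 0"
  proof (rule sum_involution_eq_0[where
        f = "\<lambda>(u, d, e). (2 * d + 3 * u - 2 * e, 2 * e - 2 * u - d, 2 * d + 2 * u - e)"],
      goal_cases)
    case (3 x)
    then show ?case using odds chi3 by (auto simp: algebra_simps)
  qed (auto simp: quad_div_def power2_eq_square algebra_simps)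
  have fin: "finite ?S1" "finite ?S2" "finite ?S3"
    by (auto intro: finite_subset[OF _ finite_quad_div[of 2 N]])
  have pos: "d > 0" "e > 0" if "(u, d, e) \<in> ?S" for u d e
    using that by (auto simp: quad_div_def)
  have "?S1 \<inter> ?S2 = {}" by (force dest: pos)
  then have "sum ?G (?S1 \<union> ?S2) = 0"
    using G1 G2 fin by (simp add: sum.union_disjoint)
  then have "sum ?G ?S = 0"
    using G3 fin by (subst split, subst sum.union_disjoint) auto
  moreover have "(\<Sum>(u, d, e) \<in> ?S. u * (e - d) * chi d) = 0"
    by (rule sum_involution_eq_0[where f = "\<lambda>(u, d, e). (- u, d, e)"])
      (auto simp: quad_div_def)
  moreover have "sum ?G ?S = (\<Sum>(u, d, e) \<in> ?S. (d * e - u\<^sup>2) * chi d)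
      + (\<Sum>(u, d, e) \<in> ?S. u * (e - d) * chi d)"
    unfolding sum.distrib[symmetric]
    by (rule sum.cong) (auto simp: algebra_simps power2_eq_square)
  ultimately show ?thesis by linarith
qed

lemma alt_add: "alt (a + b) = alt a * alt b"
  and alt_minus: "alt (- a) = alt a"
  by (auto simp: alt_def)

lemma chi_odd: "odd d \<Longrightarrow> chi d = 1 \<or> chi d = - 1"
  by (auto simp: chi_def)

lemma chi_minus: "chi (- d) = - chi d"
  unfolding chi_def by presburger

text \<open>For odd \<open>x\<close>, \<open>chi x\<close> is the sign
  \<open>(-1)^((x - 1) / 2)\<close>. Halving the sum of two odd numbers and an even one leaves an
  extra 1, which causes the minus sign. The lemma describes how \<open>alt (e div 2)\<close> changes
  along the river.\<close>

lemma alt_half_add: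
  assumes "odd u" "odd d" "even e"
  shows "alt ((u + d + e) div 2) = - (chi u * chi d * alt (e div 2))"
proof -
  obtain a b j where eqs: "u = 2 * a + 1" "d = 2 * b + 1" "e = 2 * j"
    using assms by (metis evenE oddE)
  have chi: "chi (2 * k + 1) = alt k" for k
    unfolding chi_def alt_def by presburger
  have "(u + d + e) div 2 = a + b + j + 1" "e div 2 = j" unfolding eqs by simp_all
  then show ?thesis unfolding eqs by (simp add: chi alt_add) (simp add: alt_def)
qed

text \<open>The values of \<open>chi\<close> at 1, 3, 5, ... alternate between 1 and -1, so the sum
  of those below \<open>r\<close> is \<open>(1 - chi r) / 2\<close>, and there are
  \<open>(r - 1) / 2\<close> of them. This evaluates the boundary terms of the next sum.\<close>

lemma sum_chi_less:
  assumes "odd r" "r > 0"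
  shows "2 * (\<Sum>d | odd d \<and> 0 < d \<and> d < r. chi r - chi d) = chi r * r - 1"
proof -
  define D where "D n = {d :: int. odd d \<and> 0 < d \<and> d < 2 * int n + 1}" for n
  have D_Suc: "D (Suc n) = insert (2 * int n + 1) (D n)" for n
    unfolding D_def by (auto; presburger)
  have fin: "finite (D n)" for n
    by (rule finite_subset[of _ "{0..2 * int n + 1}"]) (auto simp: D_def)
  have notin: "2 * int n + 1 \<notin> D n" for n by (simp add: D_def)
  have chi_Suc: "chi (2 * int (Suc n) + 1) = - chi (2 * int n + 1)" for n
    unfolding chi_def by simp presburger
  have D: "int (card (D n)) = int n \<and> 2 * (\<Sum>d \<in> D n. chi d) = 1 - chi (2 * int n + 1)" for n
  proof (induction n)
    case 0
    then show ?case by (auto simp: D_def chi_def)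
  next
    case (Suc n)
    then show ?case unfolding chi_Suc unfolding D_Suc using fin notin by simp
  qed
  obtain k where "r = 2 * k + 1" using assms(1) by (rule oddE)
  then have r: "r = 2 * int (nat k) + 1" using assms(2) by simp
  have "(\<Sum>d | odd d \<and> 0 < d \<and> d < r. chi r - chi d) = (\<Sum>d \<in> D (nat k). chi r - chi d)"
    by (simp add: D_def r)
  also have "\<dots> = int (nat k) * chi r - (\<Sum>d \<in> D (nat k). chi d)"
    using D by (simp add: sum_subtractf)
  finally show ?thesis using D[of "nat k"] unfolding r[symmetric]
    by (simp add: algebra_simps) (subst (3) r, simp add: algebra_simps)
qed

text \<open>
  Again the involutions move along the river of \<open>d x\<^sup>2 + u x y - e y\<^sup>2\<close>, and \<open>alt (e div 2) * chi u\<close>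
  is odd in \<open>u\<close>. When \<open>N\<close> is a square the river can end at a vector of value \<open>d + u - e = 0\<close>;
  these boundary terms \<open>?B\<close> are the only ones that survive.
\<close>

lemma sum_quad_div_alt:
  assumes N: "N mod 8 = 1"
  shows "2 * (\<Sum>(u, d, e) \<in> {(u, d, e) \<in> quad_div 4 N. odd d}. alt (e div 2) * chi d)
    = (\<Sum>r | r > 0 \<and> r\<^sup>2 = N. chi r * r - 1)"
proof -
  let ?S = "{(u, d, e) \<in> quad_div 4 N. odd d}"
  let ?G = "\<lambda>(u, d, e). alt (e div 2) * (chi d + chi u)"
  \<comment> \<open>The regions are given by the signs of the form at (1, 1) and (1, 2). The value
    at (1, 2) is odd and never vanishes; the value at (1, 1) can vanish, which is the case
    \<open>?B\<close>.\<close>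
  let ?B = "{(u, d, e) \<in> ?S. e = u + d}"
  let ?S1 = "{(u, d, e) \<in> ?S. e > u + d}"
  let ?S2 = "{(u, d, e) \<in> ?S. d + 2 * u - 4 * e > 0}"
  let ?S3 = "{(u, d, e) \<in> ?S. e < u + d \<and> d + 2 * u - 4 * e < 0}"
  have parity: "odd u" "odd d" "even e" "d > 0" "e > 0" if "(u, d, e) \<in> ?S" for u d e
  proof -
    have eq: "u\<^sup>2 + 4 * (d * e) = N" and d: "odd d" and pos: "d > 0" "e > 0"
      using that by (auto simp: quad_div_def)
    have "odd N" using N by presburger
    then show "odd u" unfolding eq[symmetric] by simp
    then have "(1 + 4 * (d * e)) mod 8 = 1"
      using N odd_square_mod_8[of u] unfolding eq[symmetric] by (metis mod_add_left_eq)
    moreover have "even x" if "(1 + 4 * x) mod 8 = 1" for x :: int using that by presburger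
    ultimately have "even (d * e)" by blast
    then show "odd d" "even e" "d > 0" "e > 0" using d pos by auto
  qed
  have fin: "finite ?S"
    by (rule finite_subset[OF _ finite_quad_div[of 4 N]]) auto
  have split: "?S = ?B \<union> ?S1 \<union> (?S2 \<union> ?S3)"
  proof (rule subset_antisym)
    show "?S \<subseteq> ?B \<union> ?S1 \<union> (?S2 \<union> ?S3)"
    proof
      fix x assume x_in: "x \<in> ?S"
      obtain u d e where x: "x = (u, d, e)" by (cases x)
      have "odd d" using x_in by (simp add: x)
      then have "d + 2 * u - 4 * e \<noteq> 0" by presburger
      then consider "e = u + d" | "e > u + d" | "d + 2 * u - 4 * e > 0"
        | "e < u + d" "d + 2 * u - 4 * e < 0" by linarith
      then show "x \<in> ?B \<union> ?S1 \<union> (?S2 \<union> ?S3)"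
        by cases (use x_in in \<open>auto simp: x\<close>)
    qed
  qed blast
  \<comment> \<open>On \<open>?S1\<close> and \<open>?S3\<close> the factor
    \<open>alt (e div 2)\<close> is multiplied by \<open>- (chi u * chi d)\<close>, which is -1
    unless \<open>chi d + chi u\<close> is zero; \<open>chi d\<close> and \<open>chi u\<close>
    themselves are kept. On \<open>?S2\<close> it is \<open>e\<close> that is kept, and both
    characters change sign.\<close>
  have G1: "sum ?G ?S1 = 0"
  proof (rule sum_involution_eq_0[where f = "\<lambda>(u, d, e). (- u - 2 * d, d, e - u - d)"], goal_cases)
    case (3 x)
    obtain u d e where x: "x = (u, d, e)" by (cases x)
    have "(u, d, e) \<in> ?S" using 3 by (simp add: x)
    note p = parity[OF this]
    have "chi (- u - 2 * d) = chi u" using p unfolding chi_def by presburger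
    moreover have "alt ((e - u - d) div 2) = - (chi (- u) * chi (- d) * alt (e div 2))"
      using alt_half_add[of "- u" "- d" e] p by (simp add: algebra_simps)
    ultimately show ?case
      using chi_odd[OF p(1)] chi_odd[OF p(2)] by (auto simp: x chi_minus)
  qed (auto simp: quad_div_def power2_eq_square algebra_simps)
  have G2: "sum ?G ?S2 = 0"
  proof (rule sum_involution_eq_0[where f = "\<lambda>(u, d, e). (4 * e - u, d + 2 * u - 4 * e, e)"],
      goal_cases)
    case (3 x)
    obtain u d e where x: "x = (u, d, e)" by (cases x)
    have "(u, d, e) \<in> ?S" using 3 by (simp add: x)
    note p = parity[OF this]
    have "chi (4 * e - u) = - chi u" "chi (d + 2 * u - 4 * e) = - chi d"
      using p unfolding chi_def by presburger+
    then show ?case by (simp add: x algebra_simps)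
  qed (auto simp: quad_div_def power2_eq_square algebra_simps)
  have G3: "sum ?G ?S3 = 0"
  proof (rule sum_involution_eq_0[where
        f = "\<lambda>(u, d, e). (2 * d + 3 * u - 4 * e, 4 * e - 2 * u - d, d + u - e)"], goal_cases)
    case (3 x)
    obtain u d e where x: "x = (u, d, e)" by (cases x)
    have "(u, d, e) \<in> ?S" using 3 by (simp add: x)
    note p = parity[OF this]
    have "chi (2 * d + 3 * u - 4 * e) = chi u" "chi (4 * e - 2 * u - d) = chi d"
      using p unfolding chi_def by presburger+
    moreover have "alt ((d + u - e) div 2) = - (chi u * chi d * alt (e div 2))"
    proof -
      have "(- e) div 2 = - (e div 2)" using p(3) by presburger
      then show ?thesis using alt_half_add[of u d "- e"] p by (simp add: algebra_simps alt_minus)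
    qed
    ultimately show ?case
      using chi_odd[OF p(1)] chi_odd[OF p(2)] by (auto simp: x)
  qed (auto simp: quad_div_def power2_eq_square algebra_simps)
  have fins: "finite ?B" "finite ?S1" "finite ?S2" "finite ?S3"
    by (rule finite_subset[OF _ fin]; auto)+
  have "sum ?G (?S2 \<union> ?S3) = 0"
    using G2 G3 fins by (subst sum.union_disjoint) auto
  moreover have "sum ?G (?B \<union> ?S1) = sum ?G ?B"
    using G1 fins by (subst sum.union_disjoint) auto
  moreover have "(?B \<union> ?S1) \<inter> (?S2 \<union> ?S3) = {}"
  proof -
    have False if "(u, d, e) \<in> ?S" "e \<ge> u + d" "d + 2 * u - 4 * e > 0 \<or> e < u + d" for u d e
      using that(2,3) parity(4,5)[OF that(1)] by linarith
    then show ?thesis by fastforce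
  qed
  ultimately have "sum ?G ?S = sum ?G ?B"
    using fins by (subst split, subst sum.union_disjoint) auto
  moreover have "(\<Sum>(u, d, e) \<in> ?S. alt (e div 2) * chi u) = 0"
    by (rule sum_involution_eq_0[where f = "\<lambda>(u, d, e). (- u, d, e)"])
      (auto simp: quad_div_def chi_minus)
  moreover have "sum ?G ?S = (\<Sum>(u, d, e) \<in> ?S. alt (e div 2) * chi d)
      + (\<Sum>(u, d, e) \<in> ?S. alt (e div 2) * chi u)"
    unfolding sum.distrib[symmetric] by (rule sum.cong) (auto simp: algebra_simps)
  ultimately have "(\<Sum>(u, d, e) \<in> ?S. alt (e div 2) * chi d) = sum ?G ?B" by linarith
  \<comment> \<open>On \<open>?B\<close> the number \<open>r = u + 2 * d = d + e\<close> is a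
    positive square root of \<open>N\<close>, and \<open>r\<close> together with an odd
    \<open>d < r\<close> recovers the triple. The summand is \<open>- (chi u + chi d)\<close>, and
    \<open>chi r = - chi u\<close>.\<close>
  also have "\<dots> = (\<Sum>(r, d) \<in> (SIGMA r:{r. r > 0 \<and> r\<^sup>2 = N}. {d. odd d \<and> 0 < d \<and> d < r}).
      chi r - chi d)"
  proof (rule sum.reindex_bij_witness[where i = "\<lambda>(r, d). (r - 2 * d, d, r - d)"
        and j = "\<lambda>(u, d, e). (u + 2 * d, d)"], goal_cases)
    case (5 x)
    obtain u d e where x: "x = (u, d, e)" by (cases x)
    have "(u, d, e) \<in> ?S" "e = u + d" using 5 by (auto simp: x)
    note p = parity[OF this(1)] this(2)
    have "alt (e div 2) = - (chi u * chi d)"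
      using alt_half_add[of u d 0] p by (simp add: alt_def)
    moreover have "chi (u + 2 * d) = - chi u" using p unfolding chi_def by presburger
    ultimately show ?case
      using chi_odd[OF p(1)] chi_odd[OF p(2)] by (auto simp: x)
  qed (auto simp: quad_div_def power2_eq_square algebra_simps)
  also have "\<dots> = (\<Sum>r | r > 0 \<and> r\<^sup>2 = N. \<Sum>d | odd d \<and> 0 < d \<and> d < r. chi r - chi d)"
  proof (rule sum.Sigma[symmetric])
    have "finite {d. odd d \<and> 0 < d \<and> d < r}" for r :: int
      by (rule finite_subset[of _ "{0..r}"]) auto
    then show "\<forall>r \<in> {r. r > 0 \<and> r\<^sup>2 = N}. finite {d. odd d \<and> 0 < d \<and> d < r}" by simp
    show "finite {r. r > 0 \<and> r\<^sup>2 = N}"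
    proof (rule finite_subset)
      have "r \<le> N" if "r\<^sup>2 = N" for r using abs_le_square_int[of r] that by simp
      then show "{r. r > 0 \<and> r\<^sup>2 = N} \<subseteq> {0..N}" by auto
    qed simp
  qed
  finally have "2 * (\<Sum>(u, d, e) \<in> ?S. alt (e div 2) * chi d)
      = (\<Sum>r | r > 0 \<and> r\<^sup>2 = N. 2 * (\<Sum>d | odd d \<and> 0 < d \<and> d < r. chi r - chi d))"
    by (simp add: sum_distrib_left)
  also have "\<dots> = (\<Sum>r | r > 0 \<and> r\<^sup>2 = N. chi r * r - 1)"
  proof (rule sum.cong[OF refl])
    fix r assume "r \<in> {r. r > 0 \<and> r\<^sup>2 = N}"
    moreover have "odd N" using N by presburger
    ultimately show "2 * (\<Sum>d | odd d \<and> 0 < d \<and> d < r. chi r - chi d) = chi r * r - 1"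
      using sum_chi_less[of r] by auto
  qed
  finally show ?thesis .
qed

section \<open>Symmetry of representations by odd squares\<close>

lemma finite_square_le: "finite {x :: int. x\<^sup>2 \<le> M}"
proof (rule finite_subset)
  have "x \<in> {-M..M}" if "x\<^sup>2 \<le> M" for x using abs_le_square_int[of x] that by auto
  then show "{x. x\<^sup>2 \<le> M} \<subseteq> {-M..M}" by blast
qed simp

lemma finite_sum_2_squares: "finite {(x :: int, y). x\<^sup>2 + y\<^sup>2 = M}"
proof (rule finite_subset)
  let ?B = "{x :: int. x\<^sup>2 \<le> M}"
  have "x \<in> ?B \<and> y \<in> ?B" if "x\<^sup>2 + y\<^sup>2 = M" for x y :: int
    using that zero_le_power2[of x] zero_le_power2[of y] by auto
  then show "{(x, y). x\<^sup>2 + y\<^sup>2 = M} \<subseteq> ?B \<times> ?B" by blast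
qed (simp add: finite_square_le)

lemma finite_sum_4_squares: "finite {(x :: int, y, z, w). x\<^sup>2 + y\<^sup>2 + z\<^sup>2 + w\<^sup>2 = M}"
proof (rule finite_subset)
  let ?B = "{x :: int. x\<^sup>2 \<le> M}"
  have "x \<in> ?B \<and> y \<in> ?B \<and> z \<in> ?B \<and> w \<in> ?B" if "x\<^sup>2 + y\<^sup>2 + z\<^sup>2 + w\<^sup>2 = M" for x y z w :: int
    using that zero_le_power2[of x] zero_le_power2[of y] zero_le_power2[of z] zero_le_power2[of w]
    by auto
  then show "{(x, y, z, w). x\<^sup>2 + y\<^sup>2 + z\<^sup>2 + w\<^sup>2 = M} \<subseteq> ?B \<times> ?B \<times> ?B \<times> ?B" by blast
qed (simp add: finite_square_le)

lemma sum_times_card: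
  fixes f :: "'a \<Rightarrow> int"
  assumes "finite I" "\<And>i. i \<in> I \<Longrightarrow> finite (R i)"
  shows "(\<Sum>i \<in> I. f i * int (card (R i))) = (\<Sum>(i, r) \<in> Sigma I R. f i)"
  using assms by (subst sum.Sigma[symmetric]) (simp_all add: mult.commute)

lemma sum_reindex_involution:
  fixes g :: "'a \<Rightarrow> int"
  assumes "\<And>x. x \<in> S \<Longrightarrow> f x \<in> S" "\<And>x. x \<in> S \<Longrightarrow> f (f x) = x"
    and "\<And>x. x \<in> S \<Longrightarrow> g (f x) = h x"
  shows "sum h S = sum g S"
  by (rule sum.reindex_bij_witness[where i = f and j = f]) (use assms in auto)

lemma sum_mult_diff:
  fixes a :: "'b \<Rightarrow> int"
  shows "(\<Sum>(u, k) \<in> I. g u k * (a k - c * b k))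
    = (\<Sum>(u, k) \<in> I. g u k * a k) - c * (\<Sum>(u, k) \<in> I. g u k * b k)"
  unfolding sum_distrib_left sum_subtractf[symmetric]
  by (rule sum.cong) (auto simp: algebra_simps)

definition odd_reps2 :: "int \<Rightarrow> (int \<times> int) set" where
  "odd_reps2 M = {(x, y). odd x \<and> odd y \<and> x\<^sup>2 + y\<^sup>2 = M}"

definition odd_reps4 :: "int \<Rightarrow> (int \<times> int \<times> int \<times> int) set" where
  "odd_reps4 M = {(x, y, z, w). odd x \<and> odd y \<and> odd z \<and> odd w \<and> x\<^sup>2 + y\<^sup>2 + z\<^sup>2 + w\<^sup>2 = M}"

lemma finite_odd_reps: "finite (odd_reps2 M)" "finite (odd_reps4 M)"
  unfolding odd_reps2_def odd_reps4_def
  by (rule finite_subset[OF _ finite_sum_2_squares[of M]], blast)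
    (rule finite_subset[OF _ finite_sum_4_squares[of M]], blast)

text \<open>
  Up to a constant factor the sum runs over all representations of \<open>N\<close> by odd squares, the first
  square being \<open>u\<^sup>2\<close>; by symmetry every square has the same average.
\<close>

lemma sum_odd_reps2:
  assumes N: "odd N"
  shows "(\<Sum>(u, m) \<in> quad_lin 2 N. (m - u\<^sup>2) * int (card (odd_reps2 (2 * m)))) = 0"
proof -
  let ?T = "{(u, x, y). odd u \<and> odd x \<and> odd y \<and> u\<^sup>2 + x\<^sup>2 + y\<^sup>2 = N}"
  \<comment> \<open>If \<open>2 * m = x^2 + y^2\<close>, then
    \<open>2 * (m - u^2) = N - 3 * u^2 = x^2 + y^2 - 2 * u^2\<close>, whose total vanishes by
    symmetry.\<close>
  have "2 * (\<Sum>(u, m) \<in> quad_lin 2 N. (m - u\<^sup>2) * int (card (odd_reps2 (2 * m))))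
    = (\<Sum>i \<in> quad_lin 2 N. (N - 3 * (fst i)\<^sup>2) * int (card (odd_reps2 (2 * snd i))))"
    unfolding sum_distrib_left by (rule sum.cong) (auto simp: quad_lin_def)
  also have "\<dots> = (\<Sum>(i, r) \<in> (SIGMA i:quad_lin 2 N. odd_reps2 (2 * snd i)). N - 3 * (fst i)\<^sup>2)"
    by (rule sum_times_card) (auto simp: finite_quad_lin finite_odd_reps)
  also have "\<dots> = (\<Sum>(u, x, y) \<in> ?T. N - 3 * u\<^sup>2)"
  proof (rule sum.reindex_bij_witness[where j = "\<lambda>((u, m), x, y). (u, x, y)"
        and i = "\<lambda>(u, x, y). ((u, (x\<^sup>2 + y\<^sup>2) div 2), x, y)"], goal_cases)
    case (2 a)
    then show ?case using N by (auto simp: quad_lin_def odd_reps2_def)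
  next
    case (4 a)
    obtain u x y where a: "a = (u, x, y)" by (cases a)
    have odds: "odd x" "odd y" using 4 by (auto simp: a)
    have pos: "x\<^sup>2 + y\<^sup>2 > 0" using odds by (auto simp: sum_power2_gt_zero_iff)
    have "even (x\<^sup>2 + y\<^sup>2)" using odds by simp
    then obtain m where m: "x\<^sup>2 + y\<^sup>2 = 2 * m" by (rule evenE)
    then have "m > 0" using pos by simp
    then show ?case using 4 m odds by (auto simp: a quad_lin_def odd_reps2_def)
  qed (auto simp: quad_lin_def odd_reps2_def)
  also have "\<dots> = (\<Sum>(u, x, y) \<in> ?T. x\<^sup>2) + (\<Sum>(u, x, y) \<in> ?T. y\<^sup>2) - 2 * (\<Sum>(u, x, y) \<in> ?T. u\<^sup>2)"
    unfolding sum_distrib_left sum.distrib[symmetric] sum_subtractf[symmetric]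
    by (rule sum.cong) auto
  also have "(\<Sum>(u, x, y) \<in> ?T. x\<^sup>2) = (\<Sum>(u, x, y) \<in> ?T. u\<^sup>2)"
    by (rule sum_reindex_involution[where f = "\<lambda>(u, x, y). (x, u, y)"]) auto
  also have "(\<Sum>(u, x, y) \<in> ?T. y\<^sup>2) = (\<Sum>(u, x, y) \<in> ?T. u\<^sup>2)"
    by (rule sum_reindex_involution[where f = "\<lambda>(u, x, y). (y, x, u)"]) auto
  finally show ?thesis by linarith
qed

text \<open>The same averaging with five squares, where
  \<open>4 * (m - u^2) = N - 5 * u^2\<close>.\<close>

lemma sum_odd_reps4:
  assumes N: "odd N"
  shows "(\<Sum>(u, m) \<in> quad_lin 4 N. (m - u\<^sup>2) * int (card (odd_reps4 (4 * m)))) = 0"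
proof -
  let ?T = "{(u, x, y, z, w). odd u \<and> odd x \<and> odd y \<and> odd z \<and> odd w \<and>
    u\<^sup>2 + x\<^sup>2 + y\<^sup>2 + z\<^sup>2 + w\<^sup>2 = N}"
  have "4 * (\<Sum>(u, m) \<in> quad_lin 4 N. (m - u\<^sup>2) * int (card (odd_reps4 (4 * m))))
    = (\<Sum>i \<in> quad_lin 4 N. (N - 5 * (fst i)\<^sup>2) * int (card (odd_reps4 (4 * snd i))))"
    unfolding sum_distrib_left by (rule sum.cong) (auto simp: quad_lin_def)
  also have "\<dots> = (\<Sum>(i, r) \<in> (SIGMA i:quad_lin 4 N. odd_reps4 (4 * snd i)). N - 5 * (fst i)\<^sup>2)"
    by (rule sum_times_card) (auto simp: finite_quad_lin finite_odd_reps)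
  also have "\<dots> = (\<Sum>(u, x, y, z, w) \<in> ?T. N - 5 * u\<^sup>2)"
  proof (rule sum.reindex_bij_witness[where j = "\<lambda>((u, m), x, y, z, w). (u, x, y, z, w)"
        and i = "\<lambda>(u, x, y, z, w). ((u, (x\<^sup>2 + y\<^sup>2 + z\<^sup>2 + w\<^sup>2) div 4), x, y, z, w)"], goal_cases)
    case (2 a)
    then show ?case using N by (auto simp: quad_lin_def odd_reps4_def)
  next
    case (4 a)
    obtain u x y z w where a: "a = (u, x, y, z, w)" by (cases a)
    have odds: "odd x" "odd y" "odd z" "odd w" using 4 by (auto simp: a)
    have "x\<^sup>2 + y\<^sup>2 > 0" using odds by (auto simp: sum_power2_gt_zero_iff)
    then have pos: "x\<^sup>2 + y\<^sup>2 + z\<^sup>2 + w\<^sup>2 > 0"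
      using zero_le_power2[of z] zero_le_power2[of w] by linarith
    have "4 dvd x\<^sup>2 + y\<^sup>2 + z\<^sup>2 + w\<^sup>2"
      using odds[THEN odd_square_mod_8] by presburger
    then obtain m where m: "x\<^sup>2 + y\<^sup>2 + z\<^sup>2 + w\<^sup>2 = 4 * m" by (rule dvdE)
    then have "m > 0" using pos by simp
    then show ?case using 4 m odds by (auto simp: a quad_lin_def odd_reps4_def)
  qed (auto simp: quad_lin_def odd_reps4_def)
  also have "\<dots> = (\<Sum>(u, x, y, z, w) \<in> ?T. x\<^sup>2) + (\<Sum>(u, x, y, z, w) \<in> ?T. y\<^sup>2)
      + (\<Sum>(u, x, y, z, w) \<in> ?T. z\<^sup>2) + (\<Sum>(u, x, y, z, w) \<in> ?T. w\<^sup>2)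
      - 4 * (\<Sum>(u, x, y, z, w) \<in> ?T. u\<^sup>2)"
    unfolding sum_distrib_left sum.distrib[symmetric] sum_subtractf[symmetric]
    by (rule sum.cong) auto
  also have "(\<Sum>(u, x, y, z, w) \<in> ?T. x\<^sup>2) = (\<Sum>(u, x, y, z, w) \<in> ?T. u\<^sup>2)"
    by (rule sum_reindex_involution[where f = "\<lambda>(u, x, y, z, w). (x, u, y, z, w)"]) auto
  also have "(\<Sum>(u, x, y, z, w) \<in> ?T. y\<^sup>2) = (\<Sum>(u, x, y, z, w) \<in> ?T. u\<^sup>2)"
    by (rule sum_reindex_involution[where f = "\<lambda>(u, x, y, z, w). (y, x, u, z, w)"]) auto
  also have "(\<Sum>(u, x, y, z, w) \<in> ?T. z\<^sup>2) = (\<Sum>(u, x, y, z, w) \<in> ?T. u\<^sup>2)"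
    by (rule sum_reindex_involution[where f = "\<lambda>(u, x, y, z, w). (z, x, y, u, w)"]) auto
  also have "(\<Sum>(u, x, y, z, w) \<in> ?T. w\<^sup>2) = (\<Sum>(u, x, y, z, w) \<in> ?T. u\<^sup>2)"
    by (rule sum_reindex_involution[where f = "\<lambda>(u, x, y, z, w). (w, x, y, z, u)"]) auto
  finally show ?thesis by linarith
qed

lemma odd_square_less_9: "odd x \<Longrightarrow> x\<^sup>2 < 9 \<Longrightarrow> x \<in> {1, -1}" for x :: int
proof (rule ccontr)
  assume "odd x" and h: "x\<^sup>2 < 9" "x \<notin> {1, -1}"
  then have "\<bar>x\<bar> \<ge> 3" by (simp; presburger)
  then have "3\<^sup>2 \<le> \<bar>x\<bar>\<^sup>2" by (intro power_mono) auto
  then show False using h by simp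
qed

section \<open>Divisor formulas for two and four squares\<close>

text \<open>Both sides satisfy the same recursion and agree at \<open>m = 1\<close>. The recursion
  stays within the class 1 modulo 4, because odd squares are 1 modulo 8, and
  \<open>2 * m + 1\<close> is then 3 modulo 8 as \<open>sum_quad_div_2\<close> demands.\<close>

lemma card_odd_reps2:
  assumes "m mod 4 = 1" "m > 0"
  shows "int (card (odd_reps2 (2 * m))) = 4 * (\<Sum>d | d > 0 \<and> d dvd m. chi d)"
proof -
  let ?A = "\<lambda>m. int (card (odd_reps2 (2 * m))) - 4 * (\<Sum>d | d > 0 \<and> d dvd m. chi d)"
  have "?A m = 0"
  proof (rule quad_lin_recursion_unique[where A = ?A and c = 2 and P = "\<lambda>m. m mod 4 = 1"])
    fix m :: int assume m: "m mod 4 = 1" "m > 0"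
    let ?I = "quad_lin 2 (2 * m + 1)"
    have "(2 * m + 1) mod 8 = 3" using m by presburger
    then have "(\<Sum>(u, k) \<in> ?I. (k - u\<^sup>2) * (\<Sum>d | d > 0 \<and> d dvd k. chi d)) = 0"
      using sum_quad_div[of 2 "\<lambda>u k. k - u\<^sup>2" chi] sum_quad_div_2 by simp
    moreover have "(\<Sum>(u, k) \<in> ?I. (k - u\<^sup>2) * ?A k)
      = (\<Sum>(u, k) \<in> ?I. (k - u\<^sup>2) * int (card (odd_reps2 (2 * k))))
      - 4 * (\<Sum>(u, k) \<in> ?I. (k - u\<^sup>2) * (\<Sum>d | d > 0 \<and> d dvd k. chi d))"
      by (rule sum_mult_diff)
    ultimately show "(\<Sum>(u, k) \<in> ?I. (k - u\<^sup>2) * ?A k) = 0" using sum_odd_reps2 by simp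
  next
    have "x \<in> {1, -1} \<and> y \<in> {1, -1}" if "odd x" "odd y" "x\<^sup>2 + y\<^sup>2 = 2" for x y :: int
      using that zero_le_power2[of x] zero_le_power2[of y]
      by (intro conjI odd_square_less_9) linarith+
    then have "odd_reps2 (2 * 1) \<subseteq> {1, -1} \<times> {1, -1}"
      unfolding odd_reps2_def by fastforce
    moreover have "{1, -1} \<times> {1, -1} \<subseteq> odd_reps2 (2 * 1)"
      by (auto simp: odd_reps2_def)
    ultimately have "odd_reps2 (2 * 1) = {1, -1} \<times> {1, -1}" by (rule subset_antisym)
    then have "card (odd_reps2 (2 * 1)) = 4" by simp
    moreover have "{d :: int. d > 0 \<and> d dvd 1} = {1}" by auto
    ultimately show "?A 1 = 0" by (simp add: chi_def)
  next
    fix m u k assume m: "m mod 4 = (1 :: int)" and "(u, k) \<in> quad_lin 2 (2 * m + 1)"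
    then have eq: "u\<^sup>2 + 2 * k = 2 * m + 1" by (simp add: quad_lin_def)
    have "odd (u\<^sup>2 + 2 * k)" unfolding eq by simp
    then have "u\<^sup>2 mod 8 = 1" by (auto intro: odd_square_mod_8)
    then show "k mod 4 = 1" using m eq by presburger
  qed (use assms in auto)
  then show ?thesis by simp
qed

text \<open>As for two squares, now with the recursion staying among odd \<open>m\<close>. Then
  \<open>4 * m + 1\<close> is 5 modulo 8, hence not a square, and \<open>sum_quad_div_4\<close>
  applies. The factor 16 counts the signs in \<open>4 = 1 + 1 + 1 + 1\<close>.\<close>

lemma card_odd_reps4:
  assumes "odd m" "m > 0"
  shows "int (card (odd_reps4 (4 * m))) = 16 * (\<Sum>d | d > 0 \<and> d dvd m. d)"
proof -
  let ?A = "\<lambda>m. int (card (odd_reps4 (4 * m))) - 16 * (\<Sum>d | d > 0 \<and> d dvd m. d)"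
  have "?A m = 0"
  proof (rule quad_lin_recursion_unique[where A = ?A and c = 4 and P = odd])
    fix m :: int assume m: "odd m" "m > 0"
    let ?I = "quad_lin 4 (4 * m + 1)"
    have "r\<^sup>2 \<noteq> 4 * m + 1" for r
    proof
      assume r: "r\<^sup>2 = 4 * m + 1"
      then have "odd (r\<^sup>2)" by simp
      then have "r\<^sup>2 mod 8 = 1" by (auto intro: odd_square_mod_8)
      then show False using r m by presburger
    qed
    then have "(\<Sum>(u, k) \<in> ?I. (k - u\<^sup>2) * (\<Sum>d | d > 0 \<and> d dvd k. d)) = 0"
      using sum_quad_div[of 4 "\<lambda>u k. k - u\<^sup>2" "\<lambda>d. d"] sum_quad_div_4 by simp
    moreover have "(\<Sum>(u, k) \<in> ?I. (k - u\<^sup>2) * ?A k)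
      = (\<Sum>(u, k) \<in> ?I. (k - u\<^sup>2) * int (card (odd_reps4 (4 * k))))
      - 16 * (\<Sum>(u, k) \<in> ?I. (k - u\<^sup>2) * (\<Sum>d | d > 0 \<and> d dvd k. d))"
      by (rule sum_mult_diff)
    ultimately show "(\<Sum>(u, k) \<in> ?I. (k - u\<^sup>2) * ?A k) = 0" using sum_odd_reps4 by simp
  next
    have "x \<in> {1, -1} \<and> y \<in> {1, -1} \<and> z \<in> {1, -1} \<and> w \<in> {1, -1}"
      if "odd x" "odd y" "odd z" "odd w" "x\<^sup>2 + y\<^sup>2 + z\<^sup>2 + w\<^sup>2 = 4" for x y z w :: int
      using that zero_le_power2[of x] zero_le_power2[of y] zero_le_power2[of z] zero_le_power2[of w]
      by (intro conjI odd_square_less_9) linarith+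
    then have "odd_reps4 (4 * 1) \<subseteq> {1, -1} \<times> {1, -1} \<times> {1, -1} \<times> {1, -1}"
      unfolding odd_reps4_def by fastforce
    moreover have "{1, -1} \<times> {1, -1} \<times> {1, -1} \<times> {1, -1} \<subseteq> odd_reps4 (4 * 1)"
      by (auto simp: odd_reps4_def)
    ultimately have "odd_reps4 (4 * 1) = {1, -1} \<times> {1, -1} \<times> {1, -1} \<times> {1, -1}"
      by (rule subset_antisym)
    then have "card (odd_reps4 (4 * 1)) = 16" by simp
    moreover have "{d :: int. d > 0 \<and> d dvd 1} = {1}" by auto
    ultimately show "?A 1 = 0" by simp
  next
    fix m u k assume m: "odd (m :: int)" and "(u, k) \<in> quad_lin 4 (4 * m + 1)"
    then have eq: "u\<^sup>2 + 4 * k = 4 * m + 1" by (simp add: quad_lin_def)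
    have "odd (u\<^sup>2 + 4 * k)" unfolding eq by simp
    then have "u\<^sup>2 mod 8 = 1" by (auto intro: odd_square_mod_8)
    then show "odd k" using m eq by presburger
  qed (use assms in auto)
  then show ?thesis by simp
qed

lemma chi_mult: "chi (a * b) = chi a * chi b"
proof (cases "even a \<or> even b")
  case False
  then have "a mod 4 \<in> {1, 3}" "b mod 4 \<in> {1, 3}" by (simp; presburger)+
  moreover have "(a * b) mod 4 = ((a mod 4) * (b mod 4)) mod 4" by (simp add: mod_mult_eq)
  ultimately show ?thesis using False by (auto simp: chi_def)
qed (auto simp: chi_def)

text \<open>The map from \<open>(x, y)\<close> to \<open>(x + y, x - y)\<close> doubles the sum of
  squares. It reduces even \<open>m\<close> to \<open>m / 2\<close>, where the divisor sum is
  unchanged because \<open>chi\<close> vanishes on even numbers, and it takes \<open>m\<close>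
  congruent to 1 modulo 4 to two odd squares. For \<open>m\<close> congruent to 3 both sides are
  zero: \<open>chi m = - 1\<close>, so exchanging \<open>d\<close> and \<open>m div d\<close>
  reverses signs.\<close>

lemma card_sum_2_squares:
  assumes "m > 0"
  shows "int (card {(x :: int, y). x\<^sup>2 + y\<^sup>2 = m}) = 4 * (\<Sum>d | d > 0 \<and> d dvd m. chi d)"
  using assms
proof (induction "nat m" arbitrary: m rule: less_induct)
  case (less m)
  let ?R = "\<lambda>m. {(x :: int, y). x\<^sup>2 + y\<^sup>2 = m}"
  have fin: "finite {d :: int. d > 0 \<and> d dvd k}" if "k > 0" for k
    by (rule finite_subset[of _ "{0..k}"]) (use that in \<open>auto dest: zdvd_imp_le\<close>)
  have "even m \<or> m mod 4 = 1 \<or> m mod 4 = 3" by presburger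
  then consider "even m" | "m mod 4 = 1" | "m mod 4 = 3" by blast
  then show ?case
  proof cases
    case 1
    then obtain k where k: "m = 2 * k" by (rule evenE)
    have "k > 0" using less.prems k by simp
    have par: "even (x + y)" "even (x - y)" if "x\<^sup>2 + y\<^sup>2 = 2 * k" for x y
    proof -
      have "even (x\<^sup>2 + y\<^sup>2)" unfolding that by simp
      then show "even (x + y)" "even (x - y)" by simp_all
    qed
    have "bij_betw (\<lambda>(x, y). (x + y, x - y)) (?R k) (?R m)"
    proof (rule bij_betw_byWitness[where f' = "\<lambda>(x, y). ((x + y) div 2, (x - y) div 2)"])
      show "(\<lambda>(x, y). ((x + y) div 2, (x - y) div 2)) ` ?R m \<subseteq> ?R k"
      proof (rule image_subsetI)
        fix p assume p_in: "p \<in> ?R m"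
        obtain x y where p: "p = (x, y)" by (cases p)
        have h: "x\<^sup>2 + y\<^sup>2 = 2 * k" using p_in by (simp add: p k)
        then obtain a b where ab: "x + y = 2 * a" "x - y = 2 * b"
          using par[of x y] by (metis evenE)
        then have xy: "x = a + b" "y = a - b" by linarith+
        have "a\<^sup>2 + b\<^sup>2 = k" using h unfolding xy by (simp add: power2_eq_square algebra_simps)
        then show "(\<lambda>(x, y). ((x + y) div 2, (x - y) div 2)) p \<in> ?R k" by (simp add: p ab)
      qed
      show "\<forall>p \<in> ?R m. (\<lambda>(x, y). (x + y, x - y)) ((\<lambda>(x, y). ((x + y) div 2, (x - y) div 2)) p) = p"
      proof
        fix p assume p_in: "p \<in> ?R m"
        obtain x y where p: "p = (x, y)" by (cases p)
        have "x\<^sup>2 + y\<^sup>2 = 2 * k" using p_in by (simp add: p k)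
        then obtain a b where "x + y = 2 * a" "x - y = 2 * b"
          using par[of x y] by (metis evenE)
        then have "x = a + b" "y = a - b" by linarith+
        then show "(\<lambda>(x, y). (x + y, x - y)) ((\<lambda>(x, y). ((x + y) div 2, (x - y) div 2)) p) = p"
          by (simp add: p)
      qed
    qed (auto simp: k power2_eq_square algebra_simps)
    then have "card (?R m) = card (?R k)" by (simp add: bij_betw_same_card)
    moreover have "(\<Sum>d | d > 0 \<and> d dvd m. chi d) = (\<Sum>d | d > 0 \<and> d dvd k. chi d)"
    proof (rule sum.mono_neutral_right)
      have "d dvd k" if "d dvd m" "odd d" for d
        using that by (simp add: k coprime_dvd_mult_right_iff)
      then show "\<forall>d \<in> {d. d > 0 \<and> d dvd m} - {d. d > 0 \<and> d dvd k}. chi d = 0"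
        by (auto simp: chi_def)
    qed (use fin[OF less.prems] in \<open>auto simp: k\<close>)
    ultimately show ?thesis using less.hyps[of k] k \<open>k > 0\<close> by simp
  next
    case 2
    have "bij_betw (\<lambda>(x, y). (x + y, x - y)) (?R m) (odd_reps2 (2 * m))"
    proof (rule bij_betw_byWitness[where f' = "\<lambda>(x, y). ((x + y) div 2, (x - y) div 2)"])
      show "(\<lambda>(x, y). (x + y, x - y)) ` ?R m \<subseteq> odd_reps2 (2 * m)"
      proof (rule image_subsetI)
        fix p assume p_in: "p \<in> ?R m"
        obtain x y where p: "p = (x, y)" by (cases p)
        have h: "x\<^sup>2 + y\<^sup>2 = m" using p_in by (simp add: p)
        have "odd (x\<^sup>2 + y\<^sup>2)" unfolding h using 2 by presburger
        then show "(\<lambda>(x, y). (x + y, x - y)) p \<in> odd_reps2 (2 * m)"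
          unfolding h[symmetric] by (simp add: p odd_reps2_def power2_eq_square algebra_simps)
      qed
      show "(\<lambda>(x, y). ((x + y) div 2, (x - y) div 2)) ` odd_reps2 (2 * m) \<subseteq> ?R m"
      proof (rule image_subsetI)
        fix p assume p_in: "p \<in> odd_reps2 (2 * m)"
        obtain x y where p: "p = (x, y)" by (cases p)
        have h: "(x, y) \<in> odd_reps2 (2 * m)" using p_in by (simp add: p)
        then have "even (x + y)" "even (x - y)" by (auto simp: odd_reps2_def)
        then obtain a b where ab: "x + y = 2 * a" "x - y = 2 * b" by (metis evenE)
        then have xy: "x = a + b" "y = a - b" by linarith+
        have "a\<^sup>2 + b\<^sup>2 = m"
          using h unfolding xy by (simp add: odd_reps2_def power2_eq_square algebra_simps)
        then show "(\<lambda>(x, y). ((x + y) div 2, (x - y) div 2)) p \<in> ?R m" by (simp add: p ab)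
      qed
    qed (auto simp: odd_reps2_def elim!: oddE)
    then have "card (?R m) = card (odd_reps2 (2 * m))" by (rule bij_betw_same_card)
    then show ?thesis using card_odd_reps2[OF 2 less.prems] by simp
  next
    case 3
    have "?R m = {}"
    proof -
      have sq: "x\<^sup>2 mod 4 = 0 \<or> x\<^sup>2 mod 4 = 1" for x :: int
      proof (cases "even x")
        case True
        then show ?thesis by (auto elim: evenE simp: power2_eq_square)
      next
        case False
        then have "x\<^sup>2 mod 8 = 1" by (rule odd_square_mod_8)
        then show ?thesis by presburger
      qed
      have "a + b \<noteq> m" if "a mod 4 = 0 \<or> a mod 4 = 1" "b mod 4 = 0 \<or> b mod 4 = 1" for a b
        using that 3 by presburger
      then have "x\<^sup>2 + y\<^sup>2 \<noteq> m" for x y using sq by blast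
      then show ?thesis by blast
    qed
    moreover have "(\<Sum>d | d > 0 \<and> d dvd m. chi d) = 0"
    proof (rule sum_involution_eq_0[where f = "\<lambda>d. m div d"])
      fix d assume "d \<in> {d. d > 0 \<and> d dvd m}"
      then obtain e where e: "m = d * e" "d > 0" by auto
      then have "e > 0" using less.prems by (simp add: zero_less_mult_iff)
      have "chi d * chi e = - 1"
        unfolding chi_mult[symmetric] e(1)[symmetric] using 3 unfolding chi_def by presburger
      then have "chi e = - chi d" by (auto simp: chi_def split: if_splits)
      then show "m div d \<in> {d. d > 0 \<and> d dvd m}" "m div (m div d) = d" "chi (m div d) = - chi d"
        using e \<open>e > 0\<close> by auto
    qed
    ultimately show ?thesis by (simp add: case_prod_beta)
  qed
qed

section \<open>The alternating ternary sum\<close>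

lemma even_iff_mod_8_eq_1:
  fixes u k N :: int
  assumes "odd u" "u\<^sup>2 + 4 * k = N"
  shows "even k \<longleftrightarrow> N mod 8 = 1"
  using assms(2) odd_square_mod_8[OF assms(1)] by presburger

text \<open>In terms of theta constants this is
  \<open>theta_2 * theta_3 * theta_4 = 2 * eta^3\<close>. If \<open>N\<close> is 5 modulo 8, exactly
  one of \<open>a\<close> and \<open>b\<close> is odd, so exchanging them reverses the sign, and
  \<open>N\<close> has no square root. If \<open>N\<close> is 1 modulo 8, then \<open>a\<close> and
  \<open>b\<close> have equal parity and the sign depends only on \<open>a^2 + b^2\<close>; the
  two-square theorem leads to \<open>sum_quad_div_alt\<close>.\<close>

lemma sum_alt_ternary:
  assumes N: "N mod 4 = 1"
  shows "(\<Sum>(u, a, b) \<in> {(u, a, b). odd u \<and> u\<^sup>2 + 4 * a\<^sup>2 + 4 * b\<^sup>2 = N}. alt a)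
    = 2 * (\<Sum>r | r mod 4 = 1 \<and> r\<^sup>2 = N. r)"
proof -
  let ?T = "{(u, a, b). odd u \<and> u\<^sup>2 + 4 * a\<^sup>2 + 4 * b\<^sup>2 = N}"
  have "N mod 8 = 5 \<or> N mod 8 = 1" using N by presburger
  then show ?thesis
  proof
    assume N5: "N mod 8 = 5"
    have "(\<Sum>(u, a, b) \<in> ?T. alt a) = 0"
    proof (rule sum_involution_eq_0[where f = "\<lambda>(u, a, b). (u, b, a)"], goal_cases)
      case (3 x)
      obtain u a b where x: "x = (u, a, b)" by (cases x)
      have "odd u" and eq: "u\<^sup>2 + 4 * (a\<^sup>2 + b\<^sup>2) = N" using 3 by (auto simp: x)
      then have "odd (a\<^sup>2 + b\<^sup>2)" using even_iff_mod_8_eq_1[of u "a\<^sup>2 + b\<^sup>2" N] N5 by simp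
      then show ?case by (auto simp: x alt_def)
    qed auto
    moreover have "(\<Sum>r | r mod 4 = 1 \<and> r\<^sup>2 = N. r) = 0"
    proof (rule sum.neutral, clarify)
      fix r :: int assume "r mod 4 = 1" "N = r\<^sup>2"
      moreover from this have "odd r" by presburger
      ultimately show "r = 0" using odd_square_mod_8[of r] N5 by simp
    qed
    ultimately show ?thesis by simp
  next
    assume N1: "N mod 8 = 1"
    then have "odd N" by presburger
    let ?Z = "{(u, a, b) \<in> ?T. a = 0 \<and> b = 0}"
    let ?U = "{(u, a, b) \<in> ?T. \<not> (a = 0 \<and> b = 0)}"
    let ?P = "{r. r > 0 \<and> r\<^sup>2 = N}"
    let ?R = "\<lambda>m. {(a :: int, b). a\<^sup>2 + b\<^sup>2 = m}"
    let ?J = "SIGMA i:quad_lin 4 N. ?R (snd i)"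
    have finT: "finite ?T"
    proof (rule finite_subset)
      let ?B = "{x :: int. x\<^sup>2 \<le> N}"
      have "u \<in> ?B \<and> a \<in> ?B \<and> b \<in> ?B" if "u\<^sup>2 + 4 * a\<^sup>2 + 4 * b\<^sup>2 = N" for u a b
        using that zero_le_power2[of u] zero_le_power2[of a] zero_le_power2[of b]
        unfolding mem_Collect_eq by (intro conjI; linarith)
      then show "?T \<subseteq> ?B \<times> ?B \<times> ?B" by blast
    qed (simp add: finite_square_le)
    have "(\<Sum>(u, a, b) \<in> ?U. alt a) = (\<Sum>(i, r) \<in> ?J. alt (snd i div 2))"
    proof (rule sum.reindex_bij_witness[where j = "\<lambda>(u, a, b). ((u, a\<^sup>2 + b\<^sup>2), a, b)"
          and i = "\<lambda>((u, m), a, b). (u, a, b)"], goal_cases)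
      case (5 x)
      obtain u a b where x: "x = (u, a, b)" by (cases x)
      have "odd u" and eq: "u\<^sup>2 + 4 * (a\<^sup>2 + b\<^sup>2) = N" using 5 by (auto simp: x)
      then have "even (a\<^sup>2 + b\<^sup>2)" using even_iff_mod_8_eq_1[of u "a\<^sup>2 + b\<^sup>2" N] N1 by blast
      then have par: "even a \<longleftrightarrow> even b" by simp
      have "alt ((a\<^sup>2 + b\<^sup>2) div 2) = alt a"
      proof (cases "even a")
        case True
        then obtain c d where "a = 2 * c" "b = 2 * d" using par by (metis evenE)
        then have "(a\<^sup>2 + b\<^sup>2) div 2 = 2 * (c\<^sup>2 + d\<^sup>2)" by (simp add: power2_eq_square)
        then show ?thesis using True by (simp add: alt_def)
      next
        case False
        then have "a\<^sup>2 mod 8 = 1" "b\<^sup>2 mod 8 = 1" using par by (simp_all add: odd_square_mod_8)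
        then have "odd ((a\<^sup>2 + b\<^sup>2) div 2)" by presburger
        then show ?thesis using False by (simp add: alt_def)
      qed
      then show ?case by (simp add: x)
    next
      case (2 x)
      then show ?case by (auto simp: quad_lin_def sum_power2_gt_zero_iff)
    next
      case (4 y)
      then show ?case using \<open>odd N\<close> by (auto simp: quad_lin_def algebra_simps)
    qed auto
    also have "\<dots> = (\<Sum>i \<in> quad_lin 4 N. alt (snd i div 2) * int (card (?R (snd i))))"
      by (rule sum_times_card[symmetric]) (auto simp: finite_quad_lin finite_sum_2_squares)
    also have "\<dots> = 4 * (\<Sum>(u, m) \<in> quad_lin 4 N. alt (m div 2) * (\<Sum>d | d > 0 \<and> d dvd m. chi d))"
      unfolding sum_distrib_left[of 4]
    proof (rule sum.cong[OF refl])
      fix i assume i_in: "i \<in> quad_lin 4 N"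
      obtain u m where i: "i = (u, m)" by (cases i)
      have "m > 0" using i_in by (simp add: i quad_lin_def)
      then show "alt (snd i div 2) * int (card (?R (snd i)))
        = 4 * (case i of (u, m) \<Rightarrow> alt (m div 2) * (\<Sum>d | d > 0 \<and> d dvd m. chi d))"
        using card_sum_2_squares[of m] by (simp add: i)
    qed
    also have "\<dots> = 4 * (\<Sum>(u, d, e) \<in> quad_div 4 N. alt (d * e div 2) * chi d)"
      using sum_quad_div[of 4 "\<lambda>u m. alt (m div 2)" chi N] by simp
    also have "(\<Sum>(u, d, e) \<in> quad_div 4 N. alt (d * e div 2) * chi d)
      = (\<Sum>(u, d, e) \<in> {(u, d, e) \<in> quad_div 4 N. odd d}. alt (d * e div 2) * chi d)"
      by (rule sum.mono_neutral_right) (auto simp: finite_quad_div chi_def)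
    also have "\<dots> = (\<Sum>(u, d, e) \<in> {(u, d, e) \<in> quad_div 4 N. odd d}. alt (e div 2) * chi d)"
    proof (rule sum.cong[OF refl])
      fix x assume x_in: "x \<in> {(u, d, e) \<in> quad_div 4 N. odd d}"
      obtain u d e where x: "x = (u, d, e)" by (cases x)
      have "odd d" and eq: "u\<^sup>2 + 4 * (d * e) = N" using x_in by (auto simp: x quad_div_def)
      have "odd (u\<^sup>2 + 4 * (d * e))" unfolding eq by fact
      then have "odd u" by simp
      then have "even (d * e)" using even_iff_mod_8_eq_1[of u "d * e" N] N1 eq by blast
      then obtain j where "e = 2 * j" using \<open>odd d\<close> by (auto elim: evenE)
      then have "d * e div 2 = d * j" "e div 2 = j" by simp_all
      then show "(case x of (u, d, e) \<Rightarrow> alt (d * e div 2) * chi d)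
        = (case x of (u, d, e) \<Rightarrow> alt (e div 2) * chi d)"
        using \<open>odd d\<close> by (simp add: x alt_def)
    qed
    \<comment> \<open>The \<open>- 1\<close> in the boundary terms leaves
      \<open>- 2 * card ?P\<close>. It is cancelled by the terms with \<open>a = b = 0\<close>, one
      for each square root of \<open>N\<close> of either sign.\<close>
    finally have U: "(\<Sum>(u, a, b) \<in> ?U. alt a) = 2 * (\<Sum>r \<in> ?P. chi r * r) - 2 * int (card ?P)"
      using sum_quad_div_alt[OF N1] by (simp add: sum_subtractf)
    have finP: "finite ?P" by (rule finite_subset[OF _ finite_square_le[of N]]) auto
    let ?M = "{r. r < 0 \<and> r\<^sup>2 = N}"
    have finM: "finite ?M" by (rule finite_subset[OF _ finite_square_le[of N]]) auto
    have "(\<Sum>(u, a, b) \<in> ?Z. alt a) = (\<Sum>r \<in> ?P \<union> ?M. 1)"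
    proof (rule sum.reindex_bij_witness[where j = "\<lambda>(u, a, b). u" and i = "\<lambda>r. (r, 0, 0)"],
        goal_cases)
      case (2 p)
      obtain u a b where p: "p = (u, a, b)" by (cases p)
      have "odd u" "u\<^sup>2 = N" using 2 by (auto simp: p)
      then have "u > 0 \<and> u\<^sup>2 = N \<or> u < 0 \<and> u\<^sup>2 = N" by (cases u "0 :: int" rule: linorder_cases) auto
      then show ?case by (simp add: p)
    next
      case (4 r)
      then have "r\<^sup>2 = N" by blast
      moreover from this have "odd r" using \<open>odd N\<close> by auto
      ultimately show ?case by simp
    qed (auto simp: alt_def)
    also have "\<dots> = (\<Sum>r \<in> ?P. 1) + (\<Sum>r \<in> ?M. 1)"
      by (rule sum.union_disjoint[OF finP finM]) auto
    also have "(\<Sum>r \<in> ?M. 1) = (\<Sum>r \<in> ?P. 1 :: int)"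
      by (rule sum.reindex_bij_witness[where i = uminus and j = uminus]) auto
    finally have Z: "(\<Sum>(u, a, b) \<in> ?Z. alt a) = 2 * int (card ?P)" by simp
    have "(\<Sum>(u, a, b) \<in> ?T. alt a) = (\<Sum>(u, a, b) \<in> ?Z \<union> ?U. alt a)"
      by (rule sum.cong) auto
    also have "\<dots> = (\<Sum>(u, a, b) \<in> ?Z. alt a) + (\<Sum>(u, a, b) \<in> ?U. alt a)"
      by (rule sum.union_disjoint) (auto intro: finite_subset[OF _ finT])
    also have "\<dots> = 2 * (\<Sum>r \<in> ?P. chi r * r)"
      unfolding U Z by simp
    \<comment> \<open>Exactly one of \<open>r\<close> and \<open>- r\<close> is 1 modulo 4, and for
      odd \<open>r\<close> it is \<open>chi r * r\<close>.\<close>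
    also have "(\<Sum>r \<in> ?P. chi r * r) = (\<Sum>r | r mod 4 = 1 \<and> r\<^sup>2 = N. r)"
    proof (rule sum.reindex_bij_witness[where i = abs and j = "\<lambda>r. chi r * r"], goal_cases)
      case (1 r)
      then show ?case using \<open>odd N\<close> by (auto simp: chi_def)
    next
      case (2 r)
      then have "odd r" using \<open>odd N\<close> by auto
      then have "r mod 4 = 1 \<or> r mod 4 = 3" by presburger
      moreover have "(- r) mod 4 = 1" if "r mod 4 = 3" using that by presburger
      ultimately show ?case using 2 \<open>odd r\<close> by (auto simp: chi_def)
    next
      case (3 r)
      then have "(- r) mod 4 = 3" by (simp; presburger)
      moreover have "odd r" using 3 by (simp; presburger)
      ultimately show ?case using 3 by (auto simp: chi_def abs_if)
    next
      case (4 r)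
      then show ?case by auto
    qed simp
    finally show ?thesis .
  qed
qed

section \<open>Four squares with exactly one odd, counted and with signs\<close>

definition reps4 :: "int \<Rightarrow> (int \<times> int \<times> int \<times> int) set" where
  "reps4 k = {(x, y, z, w). x\<^sup>2 + y\<^sup>2 + z\<^sup>2 + w\<^sup>2 = k}"

text \<open>
  The Hadamard transform maps \<open>reps4 k\<close> onto the elements of \<open>odd_reps4 (4 * k)\<close> with coordinate
  sum divisible by 4; changing the sign of one coordinate shows that these are one half of all.
\<close>

lemma card_reps4:
  assumes "odd k"
  shows "2 * card (reps4 k) = card (odd_reps4 (4 * k))"
proof -
  let ?O = "odd_reps4 (4 * k)"
  let ?A = "{(x, y, z, w) \<in> ?O. 4 dvd x + y + z + w}"
  let ?B = "{(x, y, z, w) \<in> ?O. \<not> 4 dvd x + y + z + w}"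
  have "bij_betw (\<lambda>(a, b, c, d). (a + b + c + d, a + b - c - d, a - b + c - d, a - b - c + d))
    (reps4 k) ?A"
  proof (rule bij_betw_byWitness[where f' = "\<lambda>(x, y, z, w). ((x + y + z + w) div 4,
        (x + y - z - w) div 4, (x - y + z - w) div 4, (x - y - z + w) div 4)"])
    show "(\<lambda>(a, b, c, d). (a + b + c + d, a + b - c - d, a - b + c - d, a - b - c + d)) ` reps4 k
      \<subseteq> ?A"
    proof (rule image_subsetI)
      fix p assume p_in: "p \<in> reps4 k"
      obtain a b c d where p: "p = (a, b, c, d)" by (cases p)
      have eq: "a\<^sup>2 + b\<^sup>2 + c\<^sup>2 + d\<^sup>2 = k" using p_in by (simp add: p reps4_def)
      have "odd (a\<^sup>2 + b\<^sup>2 + c\<^sup>2 + d\<^sup>2)" unfolding eq by fact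
      then show "(\<lambda>(a, b, c, d). (a + b + c + d, a + b - c - d, a - b + c - d, a - b - c + d)) p \<in> ?A"
        unfolding eq[symmetric]
        by (simp add: p odd_reps4_def power2_eq_square algebra_simps)
    qed
    \<comment> \<open>For odd coordinates the other three sums differ from
      \<open>x + y + z + w\<close> by twice an even number, so divisibility by 4 of one gives
      integrality of the whole inverse transform.\<close>
    have *: "\<exists>a b c d. x = a + b + c + d \<and> y = a + b - c - d \<and> z = a - b + c - d \<and> w = a - b - c + d"
      if "(x, y, z, w) \<in> ?A" for x y z w
    proof -
      have odds: "odd x" "odd y" "odd z" "odd w" and "4 dvd x + y + z + w"
        using that by (auto simp: odd_reps4_def)
      then have "4 dvd x + y - z - w" "4 dvd x - y + z - w" "4 dvd x - y - z + w"
        by presburger+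
      with \<open>4 dvd x + y + z + w\<close> obtain a b c d where "x + y + z + w = 4 * a" "x + y - z - w = 4 * b"
        "x - y + z - w = 4 * c" "x - y - z + w = 4 * d" by (metis dvdE)
      then have "x = a + b + c + d \<and> y = a + b - c - d \<and> z = a - b + c - d \<and> w = a - b - c + d"
        by linarith
      then show ?thesis by blast
    qed
    show "(\<lambda>(x, y, z, w). ((x + y + z + w) div 4, (x + y - z - w) div 4, (x - y + z - w) div 4,
        (x - y - z + w) div 4)) ` ?A \<subseteq> reps4 k"
    proof (rule image_subsetI)
      fix p assume p_in: "p \<in> ?A"
      obtain x y z w where p: "p = (x, y, z, w)" by (cases p)
      obtain a b c d where
        eqs: "x = a + b + c + d" "y = a + b - c - d" "z = a - b + c - d" "w = a - b - c + d"
        using *[of x y z w] p_in p by blast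
      have "x\<^sup>2 + y\<^sup>2 + z\<^sup>2 + w\<^sup>2 = 4 * k" using p_in by (simp add: p odd_reps4_def)
      then have "a\<^sup>2 + b\<^sup>2 + c\<^sup>2 + d\<^sup>2 = k"
        unfolding eqs by (simp add: power2_eq_square algebra_simps)
      then show "(\<lambda>(x, y, z, w). ((x + y + z + w) div 4, (x + y - z - w) div 4,
          (x - y + z - w) div 4, (x - y - z + w) div 4)) p \<in> reps4 k"
        by (simp add: p eqs reps4_def)
    qed
    show "\<forall>p \<in> ?A. (\<lambda>(a, b, c, d). (a + b + c + d, a + b - c - d, a - b + c - d, a - b - c + d))
      ((\<lambda>(x, y, z, w). ((x + y + z + w) div 4, (x + y - z - w) div 4, (x - y + z - w) div 4,
        (x - y - z + w) div 4)) p) = p"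
    proof
      fix p assume p_in: "p \<in> ?A"
      obtain x y z w where p: "p = (x, y, z, w)" by (cases p)
      obtain a b c d where
        eqs: "x = a + b + c + d" "y = a + b - c - d" "z = a - b + c - d" "w = a - b - c + d"
        using *[of x y z w] p_in p by blast
      show "(\<lambda>(a, b, c, d). (a + b + c + d, a + b - c - d, a - b + c - d, a - b - c + d))
        ((\<lambda>(x, y, z, w). ((x + y + z + w) div 4, (x + y - z - w) div 4, (x - y + z - w) div 4,
          (x - y - z + w) div 4)) p) = p"
        by (simp add: p eqs)
    qed
  qed auto
  then have "card ?A = card (reps4 k)" by (simp add: bij_betw_same_card)
  moreover have "bij_betw (\<lambda>(x, y, z, w). (- x, y, z, w)) ?A ?B"
  proof (rule bij_betw_byWitness[where f' = "\<lambda>(x, y, z, w). (- x, y, z, w)"])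
    \<comment> \<open>The coordinate sum is even and changes by \<open>2 * x\<close>, which is 2
      modulo 4.\<close>
    have flip: "4 dvd - x + y + z + w \<longleftrightarrow> \<not> 4 dvd x + y + z + w"
      if "odd x" "odd y" "odd z" "odd w" for x y z w :: int
      using that by presburger
    show "(\<lambda>(x, y, z, w). (- x, y, z, w)) ` ?A \<subseteq> ?B"
      using flip unfolding odd_reps4_def by fastforce
    show "(\<lambda>(x, y, z, w). (- x, y, z, w)) ` ?B \<subseteq> ?A"
      using flip unfolding odd_reps4_def by fastforce
  qed auto
  then have "card ?A = card ?B" by (rule bij_betw_same_card)
  moreover have "card ?O = card ?A + card ?B"
  proof -
    have "?O = ?A \<union> ?B" by blast
    then show ?thesis
      by (subst (1) \<open>?O = ?A \<union> ?B\<close>, subst card_Un_disjoint)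
        (auto intro: finite_subset[OF _ finite_odd_reps(2)[of "4 * k"]])
  qed
  ultimately show ?thesis by simp
qed

lemma sum_divisors_int:
  assumes "k > 0"
  shows "(\<Sum>d | d > 0 \<and> d dvd int k. d) = int (sigma k)"
  unfolding sigma_def of_nat_sum
  by (rule sum.reindex_bij_witness[where i = int and j = nat])
    (use assms in \<open>auto simp: nat_dvd_iff intro: dvd_pos_nat\<close>)

definition odd_reps_4_even :: "int \<Rightarrow> (int \<times> int \<times> int \<times> int) set" where
  "odd_reps_4_even k = {(u, a, b, c). odd u \<and> u\<^sup>2 + 4 * a\<^sup>2 + 4 * b\<^sup>2 + 4 * c\<^sup>2 = k}"

lemma finite_odd_reps_4_even: "finite (odd_reps_4_even k)"
proof (rule finite_subset)
  let ?B = "{x :: int. x\<^sup>2 \<le> k}"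
  have "u \<in> ?B \<and> a \<in> ?B \<and> b \<in> ?B \<and> c \<in> ?B"
    if "u\<^sup>2 + 4 * a\<^sup>2 + 4 * b\<^sup>2 + 4 * c\<^sup>2 = k" for u a b c
    using that zero_le_power2[of u] zero_le_power2[of a] zero_le_power2[of b] zero_le_power2[of c]
    unfolding mem_Collect_eq by (intro conjI; linarith)
  then show "odd_reps_4_even k \<subseteq> ?B \<times> ?B \<times> ?B \<times> ?B" unfolding odd_reps_4_even_def by blast
qed (simp add: finite_square_le)

text \<open>Modulo 4 the number of odd coordinates is 1, so a representation of \<open>k\<close> by
  four squares has exactly one odd coordinate. Its four possible positions are equally frequent, and
  Jacobi's count of \<open>8 * sigma k\<close> representations is divided by 4.\<close>

lemma card_odd_reps_4_even:
  assumes k: "k mod 4 = 1"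
  shows "card (odd_reps_4_even (int k)) = 2 * sigma k"
proof -
  let ?R = "reps4 (int k)"
  let ?o = "\<lambda>x :: int. if odd x then 1 else 0 :: int"
  have sq: "x\<^sup>2 mod 4 = ?o x" for x :: int
  proof (cases "even x")
    case True
    then show ?thesis by (auto elim: evenE simp: power2_eq_square)
  next
    case False
    then have "x\<^sup>2 mod 8 = 1" by (rule odd_square_mod_8)
    then have "x\<^sup>2 mod 4 = 1" by presburger
    then show ?thesis using False by simp
  qed
  have k4: "int k mod 4 = 1" using k by presburger
  have one: "?o x + ?o y + ?o z + ?o w = 1" if "(x, y, z, w) \<in> ?R" for x y z w
  proof -
    have "x\<^sup>2 + y\<^sup>2 + z\<^sup>2 + w\<^sup>2 = int k" using that by (simp add: reps4_def)
    moreover have "(x\<^sup>2 mod 4 + y\<^sup>2 mod 4 + z\<^sup>2 mod 4 + w\<^sup>2 mod 4) mod 4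
        = (x\<^sup>2 + y\<^sup>2 + z\<^sup>2 + w\<^sup>2) mod 4"
      by (intro mod_add_cong mod_mod_trivial)
    ultimately have "(?o x + ?o y + ?o z + ?o w) mod 4 = 1" using k4 by (simp only: sq)
    then show ?thesis
      by (cases "even x"; cases "even y"; cases "even z"; cases "even w") simp_all
  qed
  have finR: "finite ?R" unfolding reps4_def by (rule finite_sum_4_squares)
  have "(\<Sum>(x, y, z, w) \<in> ?R. 1) = (\<Sum>(x, y, z, w) \<in> ?R. ?o x) + (\<Sum>(x, y, z, w) \<in> ?R. ?o y)
      + (\<Sum>(x, y, z, w) \<in> ?R. ?o z) + (\<Sum>(x, y, z, w) \<in> ?R. ?o w)"
    unfolding sum.distrib[symmetric]
  proof (rule sum.cong[OF refl])
    fix p assume p_in: "p \<in> ?R"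
    obtain x y z w where p: "p = (x, y, z, w)" by (cases p)
    show "(case p of (x, y, z, w) \<Rightarrow> 1) = (case p of (x, y, z, w) \<Rightarrow> ?o x)
      + (case p of (x, y, z, w) \<Rightarrow> ?o y) + (case p of (x, y, z, w) \<Rightarrow> ?o z)
      + (case p of (x, y, z, w) \<Rightarrow> ?o w)"
      using one[of x y z w] p_in unfolding p prod.case by simp
  qed
  moreover have "(\<Sum>(x, y, z, w) \<in> ?R. ?o y) = (\<Sum>(x, y, z, w) \<in> ?R. ?o x)"
    by (rule sum_reindex_involution[where f = "\<lambda>(x, y, z, w). (y, x, z, w)"]) (auto simp: reps4_def)
  moreover have "(\<Sum>(x, y, z, w) \<in> ?R. ?o z) = (\<Sum>(x, y, z, w) \<in> ?R. ?o x)"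
    by (rule sum_reindex_involution[where f = "\<lambda>(x, y, z, w). (z, y, x, w)"]) (auto simp: reps4_def)
  moreover have "(\<Sum>(x, y, z, w) \<in> ?R. ?o w) = (\<Sum>(x, y, z, w) \<in> ?R. ?o x)"
    by (rule sum_reindex_involution[where f = "\<lambda>(x, y, z, w). (w, y, z, x)"]) (auto simp: reps4_def)
  moreover have "(\<Sum>(x, y, z, w) \<in> ?R. ?o x) = (\<Sum>p \<in> odd_reps_4_even (int k). 1)"
  proof -
    have "(\<Sum>(x, y, z, w) \<in> ?R. ?o x) = (\<Sum>(x, y, z, w) \<in> {(x, y, z, w) \<in> ?R. odd x}. ?o x)"
      by (rule sum.mono_neutral_right[OF finR]) auto
    also have "\<dots> = (\<Sum>p \<in> odd_reps_4_even (int k). 1)"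
    proof (rule sum.reindex_bij_witness[where i = "\<lambda>(u, a, b, c). (u, 2 * a, 2 * b, 2 * c)"
          and j = "\<lambda>(x, y, z, w). (x, y div 2, z div 2, w div 2)"], goal_cases)
      case (1 p)
      obtain x y z w where p: "p = (x, y, z, w)" by (cases p)
      have "even y" "even z" "even w" using 1 one[of x y z w] by (auto simp: p split: if_splits)
      then show ?case by (simp add: p)
    next
      case (2 p)
      obtain x y z w where p: "p = (x, y, z, w)" by (cases p)
      have "even y" "even z" "even w" using 2 one[of x y z w] by (auto simp: p split: if_splits)
      then obtain a b c where "y = 2 * a" "z = 2 * b" "w = 2 * c" by (metis evenE)
      then show ?case using 2 by (simp add: p reps4_def odd_reps_4_even_def power_mult_distrib)
    qed (auto simp: reps4_def odd_reps_4_even_def power_mult_distrib)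
    finally show ?thesis .
  qed
  ultimately have "int (card ?R) = 4 * int (card (odd_reps_4_even (int k)))" by (simp add: case_prod_beta)
  moreover have "odd (int k)" "k > 0" using k by presburger+
  then have "int (card (odd_reps4 (4 * int k))) = 16 * int (sigma k)"
    using card_odd_reps4[of "int k"] by (simp add: sum_divisors_int)
  moreover have "2 * card ?R = card (odd_reps4 (4 * int k))"
    by (rule card_reps4) fact
  ultimately show ?thesis by linarith
qed

text \<open>For fixed \<open>c\<close>, \<open>sum_alt_ternary\<close> collapses the sum over the
  other three coordinates to the square roots of \<open>k - 4 * c^2\<close>; then \<open>c\<close>
  becomes the variable \<open>s\<close> of \<open>S_sum\<close>.\<close>

lemma sum_alt_odd_reps_4_even:
  assumes k: "k mod 4 = 1"
  shows "(\<Sum>(u, a, b, c) \<in> odd_reps_4_even (int k). alt a) = 2 * S_sum 4 k"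
proof -
  let ?C = "{c :: int. c\<^sup>2 \<le> int k}"
  let ?T = "\<lambda>N. {(u :: int, a :: int, b :: int). odd u \<and> u\<^sup>2 + 4 * a\<^sup>2 + 4 * b\<^sup>2 = N}"
  let ?R = "\<lambda>N. {r :: int. r mod 4 = 1 \<and> r\<^sup>2 = N}"
  have k4: "int k mod 4 = 1" using k by presburger
  have le: "c\<^sup>2 \<le> int k" if "M + 4 * c\<^sup>2 = int k" "M \<ge> 0" for M c :: int
    using that zero_le_power2[of c] by linarith
  have finT: "finite (?T (int k - 4 * c\<^sup>2))" for c
    by (rule finite_subset[OF _ finite_imageI[OF finite_odd_reps_4_even[of "int k"],
      of "\<lambda>(u, a, b, c). (u, a, b)"]]) (force simp: odd_reps_4_even_def image_iff)
  have finR: "finite (?R N)" for N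
    by (rule finite_subset[OF _ finite_square_le[of N]]) auto
  have "(\<Sum>(u, a, b, c) \<in> odd_reps_4_even (int k). alt a)
    = (\<Sum>(c, u, a, b) \<in> (SIGMA c:?C. ?T (int k - 4 * c\<^sup>2)). alt a)"
  proof (rule sum.reindex_bij_witness[where i = "\<lambda>(c, u, a, b). (u, a, b, c)"
        and j = "\<lambda>(u, a, b, c). (c, u, a, b)"], goal_cases)
    case (2 p)
    obtain u a b c where p: "p = (u, a, b, c)" by (cases p)
    show ?case using 2 le[of "u\<^sup>2 + 4 * a\<^sup>2 + 4 * b\<^sup>2" c] by (auto simp: p odd_reps_4_even_def)
  qed (auto simp: odd_reps_4_even_def)
  also have "\<dots> = (\<Sum>c \<in> ?C. \<Sum>(u, a, b) \<in> ?T (int k - 4 * c\<^sup>2). alt a)"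
    by (rule sum.Sigma[symmetric], rule finite_square_le) (use finT in blast)
  also have "\<dots> = (\<Sum>c \<in> ?C. 2 * (\<Sum>r \<in> ?R (int k - 4 * c\<^sup>2). r))"
  proof (rule sum.cong[OF refl])
    fix c :: int
    have "(int k - 4 * c\<^sup>2) mod 4 = 1" using k4 by presburger
    then show "(\<Sum>(u, a, b) \<in> ?T (int k - 4 * c\<^sup>2). alt a) = 2 * (\<Sum>r \<in> ?R (int k - 4 * c\<^sup>2). r)"
      by (rule sum_alt_ternary)
  qed
  also have "\<dots> = 2 * (\<Sum>(c, r) \<in> (SIGMA c:?C. ?R (int k - 4 * c\<^sup>2)). r)"
    unfolding sum_distrib_left[symmetric]
    by (subst sum.Sigma, rule finite_square_le) (use finR in blast, rule refl)
  also have "(\<Sum>(c, r) \<in> (SIGMA c:?C. ?R (int k - 4 * c\<^sup>2)). r) = S_sum 4 k"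
    unfolding S_sum_def
  proof (rule sum.reindex_bij_witness[where i = "\<lambda>(r, s). (s, r)" and j = "\<lambda>(c, r). (r, c)"],
      goal_cases)
    case (4 p)
    obtain r s where p: "p = (r, s)" by (cases p)
    show ?case using 4 le[of "r\<^sup>2" s] by (auto simp: p cong_def)
  qed (auto simp: cong_def)
  finally show ?thesis .
qed

section \<open>From triangular numbers to squares\<close>

text \<open>The identity \<open>(x + y - 1)^2 + (x - y)^2 = 2 * x * (x - 1) + 2 * y * (y - 1) +
  1\<close> turns a pair of triangular numbers into two squares of opposite parity. The pair with
  coefficient 4 becomes \<open>b\<close> and \<open>c\<close>, whence the condition that
  \<open>b + c\<close> is odd.\<close>

lemma tri_reps_eq:
  "tri_reps 1 1 4 4 n = 2 * card {(u, a, b, c) \<in> odd_reps_4_even (4 * int n + 5). odd (b + c)}"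
proof -
  let ?k = "4 * int n + 5"
  define F where "F = {(u :: int, v, p, q). odd (u + v) \<and> odd (p + q) \<and> u\<^sup>2 + v\<^sup>2 + 4 * p\<^sup>2 + 4 * q\<^sup>2 = ?k}"
  define G where "G = {(u, a, b, c) \<in> odd_reps_4_even ?k. odd (b + c)}"
  define X where "X = {(x :: int, y :: int, z :: int, w :: int).
     int n = int 1 * (x * (x - 1) div 2) + int 1 * (y * (y - 1) div 2)
           + int 4 * (z * (z - 1) div 2) + int 4 * (w * (w - 1) div 2)}"
  have key: "(x, y, z, w) \<in> X \<longleftrightarrow> (x + y - 1)\<^sup>2 + (x - y)\<^sup>2 + 4 * (z + w - 1)\<^sup>2 + 4 * (z - w)\<^sup>2 = ?k"
    for x y z w
  proof -
    have tri: "v * v = 2 * (v * (v - 1) div 2) + v" for v :: int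
    proof -
      have "2 * (v * (v - 1) div 2) = v * (v - 1)" by (rule dvd_mult_div_cancel) simp
      then show ?thesis by (simp add: algebra_simps)
    qed
    define a b c d where "a = x * (x - 1) div 2" "b = y * (y - 1) div 2"
      "c = z * (z - 1) div 2" "d = w * (w - 1) div 2"
    note defs = this
    have "(x + y - 1)\<^sup>2 + (x - y)\<^sup>2 + 4 * (z + w - 1)\<^sup>2 + 4 * (z - w)\<^sup>2
      = 2 * (x * x) + 2 * (y * y) - 2 * x - 2 * y + 1
        + 8 * (z * z) + 8 * (w * w) - 8 * z - 8 * w + 4"
      by (simp add: power2_eq_square algebra_simps)
    also have "\<dots> = 4 * a + 4 * b + 16 * c + 16 * d + 5"
      using tri[of x] tri[of y] tri[of z] tri[of w] unfolding defs[symmetric] by linarith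
    finally show ?thesis unfolding X_def defs[symmetric] by (simp add: defs[symmetric]; linarith)
  qed
  have bij: "bij_betw (\<lambda>(x, y, z, w). (x + y - 1, x - y, z + w - 1, z - w)) X F"
  proof (rule bij_betw_byWitness[where f' = "\<lambda>(u, v, p, q).
        ((u + v + 1) div 2, (u - v + 1) div 2, (p + q + 1) div 2, (p - q + 1) div 2)"])
    show "(\<lambda>(x, y, z, w). (x + y - 1, x - y, z + w - 1, z - w)) ` X \<subseteq> F"
    proof (rule image_subsetI)
      fix t assume t_in: "t \<in> X"
      obtain x y z w where t: "t = (x, y, z, w)" by (cases t)
      have "odd ((x + y - 1) + (x - y))" "odd ((z + w - 1) + (z - w))" by presburger+
      moreover have "(x + y - 1)\<^sup>2 + (x - y)\<^sup>2 + 4 * (z + w - 1)\<^sup>2 + 4 * (z - w)\<^sup>2 = ?k"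
        using t_in unfolding t by (simp only: key)
      ultimately show "(\<lambda>(x, y, z, w). (x + y - 1, x - y, z + w - 1, z - w)) t \<in> F"
        unfolding t F_def prod.case by blast
    qed
    have *: "\<exists>x y z w. u = x + y - 1 \<and> v = x - y \<and> p = z + w - 1 \<and> q = z - w"
      if odds: "odd (u + v)" "odd (p + q)" for u v p q :: int
    proof -
      obtain i where "u + v = 2 * i + 1" using odds(1) by (rule oddE)
      moreover obtain j where "p + q = 2 * j + 1" using odds(2) by (rule oddE)
      ultimately have "u = (i + 1) + (i + 1 - v) - 1 \<and> v = (i + 1) - (i + 1 - v)
        \<and> p = (j + 1) + (j + 1 - q) - 1 \<and> q = (j + 1) - (j + 1 - q)" by linarith
      then show ?thesis by blast
    qed
    show "(\<lambda>(u, v, p, q). ((u + v + 1) div 2, (u - v + 1) div 2, (p + q + 1) div 2,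
        (p - q + 1) div 2)) ` F \<subseteq> X"
    proof (rule image_subsetI)
      fix t assume t_in: "t \<in> F"
      obtain u v p q where t: "t = (u, v, p, q)" by (cases t)
      obtain x y z w where eqs: "u = x + y - 1" "v = x - y" "p = z + w - 1" "q = z - w"
        using *[of u v p q] t_in unfolding t F_def by blast
      have "(x, y, z, w) \<in> X" using t_in unfolding t eqs key F_def by blast
      then show "(\<lambda>(u, v, p, q). ((u + v + 1) div 2, (u - v + 1) div 2, (p + q + 1) div 2,
          (p - q + 1) div 2)) t \<in> X" by (simp add: t eqs)
    qed
    show "\<forall>t \<in> F. (\<lambda>(x, y, z, w). (x + y - 1, x - y, z + w - 1, z - w)) ((\<lambda>(u, v, p, q).
        ((u + v + 1) div 2, (u - v + 1) div 2, (p + q + 1) div 2, (p - q + 1) div 2)) t) = t"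
    proof
      fix t assume t_in: "t \<in> F"
      obtain u v p q where t: "t = (u, v, p, q)" by (cases t)
      obtain x y z w where eqs: "u = x + y - 1" "v = x - y" "p = z + w - 1" "q = z - w"
        using *[of u v p q] t_in unfolding t F_def by blast
      show "(\<lambda>(x, y, z, w). (x + y - 1, x - y, z + w - 1, z - w)) ((\<lambda>(u, v, p, q).
        ((u + v + 1) div 2, (u - v + 1) div 2, (p + q + 1) div 2, (p - q + 1) div 2)) t) = t"
        by (simp add: t eqs)
    qed
  qed auto
  \<comment> \<open>Exactly one of the first two coordinates is even; it is written
    \<open>2 * a\<close>. Its two possible positions give disjoint copies of \<open>G\<close>, hence
    the factor 2.\<close>
  have "F = (\<lambda>(u, a, b, c). (u, 2 * a, b, c)) ` G \<union> (\<lambda>(u, a, b, c). (2 * a, u, b, c)) ` G"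
  proof (rule subset_antisym)
    show "F \<subseteq> (\<lambda>(u, a, b, c). (u, 2 * a, b, c)) ` G \<union> (\<lambda>(u, a, b, c). (2 * a, u, b, c)) ` G"
    proof
      fix t assume t_in: "t \<in> F"
      obtain u v p q where t: "t = (u, v, p, q)" by (cases t)
      have h: "odd (u + v)" "odd (p + q)" "u\<^sup>2 + v\<^sup>2 + 4 * p\<^sup>2 + 4 * q\<^sup>2 = ?k"
        using t_in by (simp_all add: t F_def)
      show "t \<in> (\<lambda>(u, a, b, c). (u, 2 * a, b, c)) ` G \<union> (\<lambda>(u, a, b, c). (2 * a, u, b, c)) ` G"
      proof (cases "even v")
        case True
        then obtain a where a: "v = 2 * a" by (rule evenE)
        have "(u, a, p, q) \<in> G" using h by (simp add: a G_def odd_reps_4_even_def power_mult_distrib)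
        then show ?thesis by (intro UnI1 image_eqI[of _ _ "(u, a, p, q)"]) (simp_all add: t a)
      next
        case False
        then have "even u" using h(1) by simp
        then obtain a where a: "u = 2 * a" by (rule evenE)
        have "(v, a, p, q) \<in> G"
          using h False by (simp add: a G_def odd_reps_4_even_def power_mult_distrib)
        then show ?thesis by (intro UnI2 image_eqI[of _ _ "(v, a, p, q)"]) (simp_all add: t a)
      qed
    qed
  qed (auto simp: F_def G_def odd_reps_4_even_def power_mult_distrib)
  also have "card \<dots> = card ((\<lambda>(u, a, b, c). (u, 2 * a, b, c)) ` G)
      + card ((\<lambda>(u, a, b, c). (2 * a, u, b, c)) ` G)"
  proof (rule card_Un_disjoint)
    show "finite ((\<lambda>(u, a, b, c). (u, 2 * a, b, c)) ` G)" "finite ((\<lambda>(u, a, b, c). (2 * a, u, b, c)) ` G)"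
      by (auto simp: G_def intro!: finite_imageI intro: finite_subset[OF _ finite_odd_reps_4_even[of ?k]])
    show "(\<lambda>(u, a, b, c). (u, 2 * a, b, c)) ` G \<inter> (\<lambda>(u, a, b, c). (2 * a, u, b, c)) ` G = {}"
      by (auto simp: G_def odd_reps_4_even_def)
  qed
  also have "card ((\<lambda>(u, a, b, c). (u, 2 * a, b, c)) ` G) = card G"
    by (rule card_image) (auto intro!: inj_onI)
  also have "card ((\<lambda>(u, a, b, c). (2 * a, u, b, c)) ` G) = card G"
    by (rule card_image) (auto intro!: inj_onI)
  finally have "card F = 2 * card G" by simp
  moreover have "tri_reps 1 1 4 4 n = card X" unfolding tri_reps_def X_def by simp
  ultimately show ?thesis using bij_betw_same_card[OF bij] by (simp add: G_def)
qed

theorem theorem3p1: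
  fixes n :: nat
  assumes "n > 0"
  shows "int (tri_reps 1 1 4 4 n) = 2 * (int (sigma (4 * n + 5)) + (- 1) ^ n * S_sum 4 (4 * n + 5))"
proof -
  let ?E = "odd_reps_4_even (4 * int n + 5)"
  let ?G = "{(u, a, b, c) \<in> ?E. odd (b + c)}"
  have k: "(4 * n + 5) mod 4 = 1" by presburger
  \<comment> \<open>Modulo 8 the equation forces \<open>a + b + c\<close> and \<open>n\<close> to
    have opposite parity, so \<open>b + c\<close> is odd exactly when
    \<open>(-1)^n * alt a = 1\<close>.\<close>
  have eq: "1 + (- 1) ^ n * alt a = (if odd (b + c) then 2 else 0)" if "(u, a, b, c) \<in> ?E" for u a b c
  proof -
    have "odd u" "u\<^sup>2 + 4 * (a\<^sup>2 + b\<^sup>2 + c\<^sup>2) = 4 * int n + 5"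
      using that by (auto simp: odd_reps_4_even_def)
    then have "even (a\<^sup>2 + b\<^sup>2 + c\<^sup>2) \<longleftrightarrow> (4 * int n + 5) mod 8 = 1" by (rule even_iff_mod_8_eq_1)
    also have "\<dots> \<longleftrightarrow> odd n" by presburger
    finally show ?thesis by (cases "even n") (auto simp: alt_def)
  qed
  have "2 * int (card ?G) = (\<Sum>p \<in> ?G. 2)" by simp
  also have "\<dots> = (\<Sum>(u, a, b, c) \<in> ?G. if odd (b + c) then 2 else 0)"
    by (rule sum.cong) auto
  also have "\<dots> = (\<Sum>(u, a, b, c) \<in> ?E. if odd (b + c) then 2 else 0)"
    by (rule sum.mono_neutral_left[OF finite_odd_reps_4_even]) (auto split: if_splits)
  also have "\<dots> = (\<Sum>(u, a, b, c) \<in> ?E. 1 + (- 1) ^ n * alt a)"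
    by (rule sum.cong) (auto simp: eq)
  also have "\<dots> = int (card ?E) + (- 1) ^ n * (\<Sum>(u, a, b, c) \<in> ?E. alt a)"
    by (simp add: case_prod_beta sum.distrib sum_distrib_left)
  also have "int (card ?E) = 2 * int (sigma (4 * n + 5))"
    using card_odd_reps_4_even[OF k] by simp
  also have "(\<Sum>(u, a, b, c) \<in> ?E. alt a) = 2 * S_sum 4 (4 * n + 5)"
    using sum_alt_odd_reps_4_even[OF k] by simp
  finally show ?thesis unfolding tri_reps_eq by (simp add: algebra_simps)
qed

end
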